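(* Let $q\in L^1_{\mathrm{loc}}(\mathbb R)$ with $\rho(D(q))\neq\emptyset$, and let $z_1\in\rho(D(q))$ (then necessarily $z_1\in\mathbb C\setminus\mathbb R$). Let $q^{(1)}_{z_1}$ be the potential constructed from $z_1$ and the Weyl–Titchmarsh-type solutions $\Psi_\pm(z_1,\cdot)$ as described in the context. Then $$\sigma\big(D(q^{(1)}_{z_1})\big)=\sigma(D(q))\cup\{z_1,\overline{z_1}\},\quad \sigma_{\mathrm p}\big(D(q^{(1)}_{z_1})\big)=\sigma_{\mathrm p}(D(q))\cup\{z_1,\overline{z_1}\},\quad \sigma_{\mathrm e}\big(D(q^{(1)}_{z_1})\big)=\sigma_{\mathrm e}(D(q)).$$
   Context: Let $q\in L^1_{\mathrm{loc}}(\mathbb R)$. For $z\in\mathbb C$, a $z$-wave function associated with $q$ is a function $\Psi(z,\cdot)=(\psi_1(z,\cdot),\psi_2(z,\cdot))^\top\in AC_{\mathrm{loc}}(\mathbb R)^2$, not identically zero, with $\psi_1'=-iz\psi_1+q\psi_2$, $\psi_2'=iz\psi_2-\overline{q}\psi_1$ a.e.; equivalently $M(q)\Psi=z\Psi$ with $M(q)=i\begin{pmatrix}\frac{d}{dx}&-q\\-\overline q&-\frac{d}{dx}\end{pmatrix}$. $D(q)$ is the maximal operator in $L^2(\mathbb R)^2$: $D(q)F=M(q)F$ on $\{F\in L^2(\mathbb R)^2: F\in AC_{\mathrm{loc}}(\mathbb R)^2,\ M(q)F\in L^2(\mathbb R)^2\}$. $\mathcal C$ denotes componentwise complex conjugation,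 $\sigma_1=\begin{pmatrix}0&1\\1&0\end{pmatrix}$, $\sigma_4=\begin{pmatrix}0&1\\-1&0\end{pmatrix}$, $\mathcal J=\sigma_1\mathcal C$, $\mathcal K=\sigma_4\mathcal C$, so $\mathcal K(a,b)^\top=(\overline b,-\overline a)^\top$. For $z_1\in\rho(D(q))$ there exist $z_1$-wave functions $\Psi_-(z_1,\cdot)$, $\Psi_+(z_1,\cdot)$, unique up to constant multiples and linearly independent, with $\Psi_-(z_1,\cdot)\in L^2((-\infty,R])^2$ and $\Psi_+(z_1,\cdot)\in L^2([R,\infty))^2$ for all $R\in\mathbb R$; fix such a choice and put $\Psi(z_1,x)=\Psi_-(z_1,x)+\Psi_+(z_1,x)=(\psi_1(z_1,x),\psi_2(z_1,x))^\top$ and $$q^{(1)}_{z_1}(x)=q(x)+4\,\mathrm{Im}(z_1)\,\psi_1(z_1,x)\overline{\psi_2(z_1,x)}\,\|\Psi(z_1,x)\|_{\mathbb C^2}^{-2}$$ (which lies in $L^1_{\mathrm{loc}}(\mathbb R)$). For a densely defined closed operator $S$ in a Hilbert space: $\sigma(S)$ is the spectrum, $\sigma_{\mathrm p}(S)$ the set of eigenvalues, and $\sigma_{\mathrm e}(S)$ the set of $\lambda\in\mathbb C$ for which there is a sequence $\{f_n\}\subset\mathrm{dom}(S)$ with $\|f_n\|=1$, having no convergent subsequence, and $\|(S-\lambda)f_n\|\to0$. *)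

theory Defs
  imports "HOL-Analysis.Analysis"
begin

text \<open>Elements of L^2(R)^2 are represented by functions real => complex * complex
  (the product norm is the Euclidean norm of C^2); equality in L^2 is equality a.e.
  w.r.t. Lebesgue measure.\<close>

definition L1loc :: "(real \<Rightarrow> complex) \<Rightarrow> bool" where
  "L1loc q \<longleftrightarrow> (\<forall>a b. set_integrable lebesgue {a..b} q)"

definition L2 :: "(real \<Rightarrow> complex \<times> complex) \<Rightarrow> bool" where
  "L2 F \<longleftrightarrow> F \<in> borel_measurable lebesgue \<and> integrable lebesgue (\<lambda>x. (norm (F x))\<^sup>2)"

definition L2_on :: "real set \<Rightarrow> (real \<Rightarrow> complex \<times> complex) \<Rightarrow> bool" where
  "L2_on S F \<longleftrightarrow> F \<in> borel_measurable lebesgue \<and> set_integrable lebesgue S (\<lambda>x. (norm (F x))\<^sup>2)"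

definition L2norm :: "(real \<Rightarrow> complex \<times> complex) \<Rightarrow> real" where
  "L2norm F = sqrt (\<integral>x. (norm (F x))\<^sup>2 \<partial>lebesgue)"

definition AC_loc :: "(real \<Rightarrow> 'a::real_normed_vector) \<Rightarrow> bool" where
  "AC_loc f \<longleftrightarrow> (\<forall>a b. \<forall>e>0. \<exists>d>0. \<forall>(n::nat) (I::nat \<Rightarrow> real \<times> real).
      (\<forall>k<n. a \<le> fst (I k) \<and> fst (I k) \<le> snd (I k) \<and> snd (I k) \<le> b) \<and>
      (\<forall>j<n. \<forall>k<n. j \<noteq> k \<longrightarrow> {fst (I j)<..<snd (I j)} \<inter> {fst (I k)<..<snd (I k)} = {}) \<and>
      (\<Sum>k<n. snd (I k) - fst (I k)) < d
      \<longrightarrow> (\<Sum>k<n. norm (f (snd (I k)) - f (fst (I k)))) < e)"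

definition csmul :: "complex \<Rightarrow> complex \<times> complex \<Rightarrow> complex \<times> complex" where
  "csmul z p = (z * fst p, z * snd p)"

text \<open>Graph of the maximal operator D(q): D(q) F = G (G a representative, equal a.e.
  to M(q) F = i (F1' - q F2, - conj q F1 - F2')).\<close>
definition Dgraph :: "(real \<Rightarrow> complex) \<Rightarrow> (real \<Rightarrow> complex \<times> complex)
    \<Rightarrow> (real \<Rightarrow> complex \<times> complex) \<Rightarrow> bool" where
  "Dgraph q F G \<longleftrightarrow> L2 F \<and> AC_loc F \<and> L2 G \<and>
     (AE x in lebesgue. \<exists>d. (F has_vector_derivative d) (at x) \<and>
        G x = (\<i> * (fst d - q x * snd (F x)), \<i> * (- cnj (q x) * fst (F x) - snd d)))"

definition resolvent_set :: "(real \<Rightarrow> complex) \<Rightarrow> complex set" where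
  "resolvent_set q = {z.
     (\<forall>F G. Dgraph q F G \<and> (AE x in lebesgue. G x = csmul z (F x))
         \<longrightarrow> (AE x in lebesgue. F x = 0)) \<and>
     (\<forall>H. L2 H \<longrightarrow> (\<exists>F G. Dgraph q F G \<and> (AE x in lebesgue. G x - csmul z (F x) = H x))) \<and>
     (\<exists>C. \<forall>F G. Dgraph q F G \<longrightarrow> L2norm F \<le> C * L2norm (\<lambda>x. G x - csmul z (F x)))}"

definition spectrum_D :: "(real \<Rightarrow> complex) \<Rightarrow> complex set" where
  "spectrum_D q = - resolvent_set q"

definition point_spectrum_D :: "(real \<Rightarrow> complex) \<Rightarrow> complex set" where
  "point_spectrum_D q = {z. \<exists>F G. Dgraph q F G \<and> \<not> (AE x in lebesgue. F x = 0) \<and>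
       (AE x in lebesgue. G x = csmul z (F x))}"

definition ess_spectrum_D :: "(real \<Rightarrow> complex) \<Rightarrow> complex set" where
  "ess_spectrum_D q = {z. \<exists>f g. (\<forall>n. Dgraph q (f n) (g n) \<and> L2norm (f n) = 1) \<and>
       \<not> (\<exists>r h. strict_mono r \<and> L2 h \<and> (\<lambda>n. L2norm (\<lambda>x. f (r n) x - h x)) \<longlonglongrightarrow> 0) \<and>
       (\<lambda>n. L2norm (\<lambda>x. g n x - csmul z (f n x))) \<longlonglongrightarrow> 0}"

definition wave_function :: "(real \<Rightarrow> complex) \<Rightarrow> complex \<Rightarrow> (real \<Rightarrow> complex \<times> complex) \<Rightarrow> bool" where
  "wave_function q z \<Psi> \<longleftrightarrow> AC_loc \<Psi> \<and> (\<exists>x. \<Psi> x \<noteq> 0) \<and>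
     (AE x in lebesgue. \<exists>d. (\<Psi> has_vector_derivative d) (at x) \<and>
        fst d = - \<i> * z * fst (\<Psi> x) + q x * snd (\<Psi> x) \<and>
        snd d = \<i> * z * snd (\<Psi> x) - cnj (q x) * fst (\<Psi> x))"

end

theory Submission
  imports Defs
begin

text \<open>Write \<open>\<psi> = \<Psi>m + \<Psi>p\<close>, let \<open>P\<close> be the pointwise orthogonal projection onto the span of \<open>\<psi>\<close>, and let
  \<open>G = z1 P + cnj z1 (1 - P)\<close>. The Darboux transformation is a gauge transformation: if
  \<open>F' = (Q - i z \<sigma>3) F + h\<close>, then \<open>(z - G) F\<close> solves the system for the potential \<open>q1\<close> with
  right-hand side \<open>(z - G) h\<close>. For \<open>z\<close> different from \<open>z1\<close> and \<open>cnj z1\<close> the multiplication operator \<open>z - G\<close> is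
  boundedly invertible on \<open>L\<^sup>2\<close>, so \<open>D(q) - z\<close> and \<open>D(q1) - z\<close> have the same spectral properties.

  The Wronskian of \<open>\<Psi>m\<close> and \<open>\<Psi>p\<close> is a nonzero constant, because \<open>z1\<close> is not an eigenvalue of \<open>D(q)\<close>; so
  \<open>1 / norm \<psi>\<close> is square integrable. It is the norm of the solution \<open>(cnj \<psi>2, - cnj \<psi>1) / (norm \<psi>)\<^sup>2\<close> of the system
  for \<open>q1\<close> at \<open>z1\<close>, which is therefore an eigenfunction; the conjugation symmetry gives one at \<open>cnj z1\<close>. Finally, for
  \<open>F\<close> in the domain of \<open>D(q1)\<close> the resolvent of \<open>D(q)\<close> at \<open>z1\<close> bounds the distance of \<open>F\<close> from the span of this
  eigenfunction by the norm of \<open>(D(q1) - z1) F\<close>, so \<open>z1\<close> and \<open>cnj z1\<close> are not in the essential spectrum.\<close>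

section \<open>Absolutely continuous functions\<close>

lemma AC_locD:
  assumes "AC_loc f" "e > 0"
  obtains d where "d > 0"
    "\<And>(n::nat) I. (\<And>k. k < n \<Longrightarrow> a \<le> fst (I k) \<and> fst (I k) \<le> snd (I k) \<and> snd (I k) \<le> b) \<Longrightarrow>
      (\<And>j k. j < n \<Longrightarrow> k < n \<Longrightarrow> j \<noteq> k \<Longrightarrow> {fst (I j)<..<snd (I j)} \<inter> {fst (I k)<..<snd (I k)} = {}) \<Longrightarrow>
      (\<Sum>k<n. snd (I k) - fst (I k)) < d \<Longrightarrow>
      (\<Sum>k<n. norm (f (snd (I k)) - f (fst (I k)))) < e"
proof -
  let ?P = "\<lambda>d. \<forall>(n::nat) I.
      (\<forall>k<n. a \<le> fst (I k) \<and> fst (I k) \<le> snd (I k) \<and> snd (I k) \<le> b) \<and>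
      (\<forall>j<n. \<forall>k<n. j \<noteq> k \<longrightarrow> {fst (I j)<..<snd (I j)} \<inter> {fst (I k)<..<snd (I k)} = {}) \<and>
      (\<Sum>k<n. snd (I k) - fst (I k)) < d
      \<longrightarrow> (\<Sum>k<n. norm (f (snd (I k)) - f (fst (I k)))) < e"
  have "\<exists>d>0. ?P d"
    using assms(1)[unfolded AC_loc_def, THEN spec, THEN spec, THEN spec, THEN mp, OF assms(2)] .
  then obtain d where d: "d > 0" "?P d" by (elim exE conjE)
  show ?thesis
  proof (rule that[OF d(1)])
    fix n :: nat and I
    assume "\<And>k. k < n \<Longrightarrow> a \<le> fst (I k) \<and> fst (I k) \<le> snd (I k) \<and> snd (I k) \<le> b"
      "\<And>j k. j < n \<Longrightarrow> k < n \<Longrightarrow> j \<noteq> k \<Longrightarrow> {fst (I j)<..<snd (I j)} \<inter> {fst (I k)<..<snd (I k)} = {}"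
      "(\<Sum>k<n. snd (I k) - fst (I k)) < d"
    then show "(\<Sum>k<n. norm (f (snd (I k)) - f (fst (I k)))) < e"
      by (intro d(2)[THEN spec, THEN spec, THEN mp] conjI allI impI) simp_all
  qed
qed

lemma AC_loc_continuous:
  assumes "AC_loc f"
  shows "continuous_on UNIV f"
  unfolding continuous_on_iff
proof (intro ballI allI impI)
  fix x e :: real
  assume "e > 0"
  obtain d where "d > 0" and d: "\<And>(n::nat) I. (\<And>k. k < n \<Longrightarrow> x - 1 \<le> fst (I k) \<and> fst (I k) \<le> snd (I k) \<and> snd (I k) \<le> x + 1) \<Longrightarrow>
      (\<And>j k. j < n \<Longrightarrow> k < n \<Longrightarrow> j \<noteq> k \<Longrightarrow> {fst (I j)<..<snd (I j)} \<inter> {fst (I k)<..<snd (I k)} = {}) \<Longrightarrow>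
      (\<Sum>k<n. snd (I k) - fst (I k)) < d \<Longrightarrow>
      (\<Sum>k<n. norm (f (snd (I k)) - f (fst (I k)))) < e"
    using AC_locD[OF assms \<open>e > 0\<close>] by blast
  show "\<exists>d>0. \<forall>y\<in>UNIV. dist y x < d \<longrightarrow> dist (f y) (f x) < e"
  \<comment> \<open>The cap 1 keeps \<open>y\<close> in the window from \<open>x - 1\<close> to
    \<open>x + 1\<close>, so the single interval between \<open>x\<close> and \<open>y\<close> is an
    admissible family.\<close>
  proof (intro exI[of _ "min d 1"] conjI ballI impI)
    fix y assume y: "dist y x < min d 1"
    have "(\<Sum>k<(1::nat). norm (f (snd (min x y, max x y)) - f (fst (min x y, max x y)))) < e"
      using y by (intro d[of 1 "\<lambda>_. (min x y, max x y)"]) (auto simp: dist_real_def min_def max_def split: if_splits)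
    then show "dist (f y) (f x) < e"
      by (auto simp: dist_norm min_def max_def norm_minus_commute split: if_splits)
  qed (use \<open>d > 0\<close> in auto)
qed

text \<open>Carries the closure properties below: under a Lipschitz-type bound on compact intervals,
  one family of intervals that is fine enough for both \<open>f\<close> and \<open>g\<close> also
  controls \<open>h\<close>.\<close>

lemma AC_loc_dominated2:
  assumes f: "AC_loc f" and g: "AC_loc g"
    and le: "\<And>a b. \<exists>M. \<forall>x\<in>{a..b}. \<forall>y\<in>{a..b}. norm (h x - h y) \<le> M * (norm (f x - f y) + norm (g x - g y))"
  shows "AC_loc h"
  unfolding AC_loc_def
proof (intro allI impI)
  fix a b e :: real
  assume "e > 0"
  from le obtain M0 where M0: "\<And>x y. x \<in> {a..b} \<Longrightarrow> y \<in> {a..b} \<Longrightarrow>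
      norm (h x - h y) \<le> M0 * (norm (f x - f y) + norm (g x - g y))"
    by meson
  \<comment> \<open>The given bound may be zero or negative; a positive one is needed for the
    tolerance \<open>e / (2 * M)\<close>.\<close>
  define M where "M = max M0 1"
  have "M > 0" by (simp add: M_def)
  have M: "norm (h x - h y) \<le> M * (norm (f x - f y) + norm (g x - g y))"
    if "x \<in> {a..b}" "y \<in> {a..b}" for x y
    by (rule order_trans[OF M0[OF that] mult_right_mono]) (auto simp: M_def)
  have e: "e / (2 * M) > 0" using \<open>e > 0\<close> \<open>M > 0\<close> by simp
  obtain d1 where d1: "d1 > 0" "\<And>(n::nat) I. (\<And>k. k < n \<Longrightarrow> a \<le> fst (I k) \<and> fst (I k) \<le> snd (I k) \<and> snd (I k) \<le> b) \<Longrightarrow>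
      (\<And>j k. j < n \<Longrightarrow> k < n \<Longrightarrow> j \<noteq> k \<Longrightarrow> {fst (I j)<..<snd (I j)} \<inter> {fst (I k)<..<snd (I k)} = {}) \<Longrightarrow>
      (\<Sum>k<n. snd (I k) - fst (I k)) < d1 \<Longrightarrow>
      (\<Sum>k<n. norm (f (snd (I k)) - f (fst (I k)))) < e / (2 * M)"
    using AC_locD[OF f e] by blast
  obtain d2 where d2: "d2 > 0" "\<And>(n::nat) I. (\<And>k. k < n \<Longrightarrow> a \<le> fst (I k) \<and> fst (I k) \<le> snd (I k) \<and> snd (I k) \<le> b) \<Longrightarrow>
      (\<And>j k. j < n \<Longrightarrow> k < n \<Longrightarrow> j \<noteq> k \<Longrightarrow> {fst (I j)<..<snd (I j)} \<inter> {fst (I k)<..<snd (I k)} = {}) \<Longrightarrow>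
      (\<Sum>k<n. snd (I k) - fst (I k)) < d2 \<Longrightarrow>
      (\<Sum>k<n. norm (g (snd (I k)) - g (fst (I k)))) < e / (2 * M)"
    using AC_locD[OF g e] by blast
  show "\<exists>d>0. \<forall>(n::nat) I.
      (\<forall>k<n. a \<le> fst (I k) \<and> fst (I k) \<le> snd (I k) \<and> snd (I k) \<le> b) \<and>
      (\<forall>j<n. \<forall>k<n. j \<noteq> k \<longrightarrow> {fst (I j)<..<snd (I j)} \<inter> {fst (I k)<..<snd (I k)} = {}) \<and>
      (\<Sum>k<n. snd (I k) - fst (I k)) < d
      \<longrightarrow> (\<Sum>k<n. norm (h (snd (I k)) - h (fst (I k)))) < e"
  proof (intro exI[of _ "min d1 d2"] conjI allI impI)
    fix n :: nat and I
    assume A: "(\<forall>k<n. a \<le> fst (I k) \<and> fst (I k) \<le> snd (I k) \<and> snd (I k) \<le> b) \<and>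
      (\<forall>j<n. \<forall>k<n. j \<noteq> k \<longrightarrow> {fst (I j)<..<snd (I j)} \<inter> {fst (I k)<..<snd (I k)} = {}) \<and>
      (\<Sum>k<n. snd (I k) - fst (I k)) < min d1 d2"
    have 1: "(\<Sum>k<n. norm (f (snd (I k)) - f (fst (I k)))) < e / (2 * M)"
      using A by (intro d1(2)) auto
    have 2: "(\<Sum>k<n. norm (g (snd (I k)) - g (fst (I k)))) < e / (2 * M)"
      using A by (intro d2(2)) auto
    have "(\<Sum>k<n. norm (h (snd (I k)) - h (fst (I k))))
        \<le> (\<Sum>k<n. M * (norm (f (snd (I k)) - f (fst (I k))) + norm (g (snd (I k)) - g (fst (I k)))))"
      using A by (intro sum_mono M) force+
    also have "\<dots> = M * ((\<Sum>k<n. norm (f (snd (I k)) - f (fst (I k)))) + (\<Sum>k<n. norm (g (snd (I k)) - g (fst (I k)))))"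
      by (simp only: sum_distrib_left[symmetric] sum.distrib)
    also have "\<dots> < M * (e / (2 * M) + e / (2 * M))"
      using 1 2 \<open>M > 0\<close> by (intro mult_strict_left_mono add_strict_mono)
    also have "\<dots> = e" using \<open>M > 0\<close> by (simp add: field_simps)
    finally show "(\<Sum>k<n. norm (h (snd (I k)) - h (fst (I k)))) < e" .
  qed (use d1 d2 in auto)
qed

lemma AC_loc_dominated:
  assumes f: "AC_loc f"
    and le: "\<And>a b. \<exists>M. \<forall>x\<in>{a..b}. \<forall>y\<in>{a..b}. norm (h x - h y) \<le> M * norm (f x - f y)"
  shows "AC_loc h"
proof (rule AC_loc_dominated2[OF f f])
  fix a b :: real
  from le obtain M where "\<forall>x\<in>{a..b}. \<forall>y\<in>{a..b}. norm (h x - h y) \<le> M * norm (f x - f y)" by blast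
  then show "\<exists>M. \<forall>x\<in>{a..b}. \<forall>y\<in>{a..b}. norm (h x - h y) \<le> M * (norm (f x - f y) + norm (f x - f y))"
    by (intro exI[of _ "M/2"]) (auto simp: field_simps)
qed

lemma AC_loc_bounded_linear:
  assumes "bounded_linear T" and f: "AC_loc f"
  shows "AC_loc (\<lambda>x. T (f x))"
proof (rule AC_loc_dominated[OF f])
  interpret bounded_linear T by fact
  obtain K where "\<And>x. norm (T x) \<le> norm x * K" using bounded by blast
  then show "\<exists>M. \<forall>x\<in>{a..b}. \<forall>y\<in>{a..b}. norm (T (f x) - T (f y)) \<le> M * norm (f x - f y)" for a b
    by (metis diff mult.commute)
qed

lemma AC_loc_Pair:
  assumes "AC_loc f" "AC_loc g"
  shows "AC_loc (\<lambda>x. (f x, g x))"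
proof (rule AC_loc_dominated2[OF assms])
  show "\<exists>M. \<forall>x\<in>{a..b}. \<forall>y\<in>{a..b}. norm ((f x, g x) - (f y, g y)) \<le> M * (norm (f x - f y) + norm (g x - g y))" for a b
    by (intro exI[of _ 1] ballI) (simp add: norm_Pair_le)
qed

lemma AC_loc_add:
  assumes "AC_loc f" "AC_loc g"
  shows "AC_loc (\<lambda>x. f x + g x)"
proof (rule AC_loc_dominated2[OF assms])
  show "\<exists>M. \<forall>x\<in>{a..b}. \<forall>y\<in>{a..b}. norm (f x + g x - (f y + g y)) \<le> M * (norm (f x - f y) + norm (g x - g y))" for a b
    by (intro exI[of _ 1] ballI) (simp add: norm_diff_triangle_ineq)
qed

lemma AC_loc_minus: "AC_loc f \<Longrightarrow> AC_loc (\<lambda>x. - f x)"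
  by (rule AC_loc_bounded_linear[OF bounded_linear_minus[OF bounded_linear_ident]])

lemma AC_loc_diff:
  assumes "AC_loc f" "AC_loc g"
  shows "AC_loc (\<lambda>x. f x - g x)"
  using AC_loc_add[OF assms(1) AC_loc_minus[OF assms(2)]] by simp

lemma AC_loc_mult:
  fixes f g :: "real \<Rightarrow> 'a::real_normed_algebra"
  assumes f: "AC_loc f" and g: "AC_loc g"
  shows "AC_loc (\<lambda>x. f x * g x)"
proof (rule AC_loc_dominated2[OF f g])
  fix a b :: real
  have "bounded (f ` {a..b})" "bounded (g ` {a..b})"
    by (intro compact_imp_bounded compact_continuous_image compact_Icc
        continuous_on_subset[OF AC_loc_continuous[OF f]] continuous_on_subset[OF AC_loc_continuous[OF g]] subset_UNIV)+
  then obtain B1 B2 where B1: "\<forall>x\<in>{a..b}. norm (f x) \<le> B1" and B2: "\<forall>x\<in>{a..b}. norm (g x) \<le> B2"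
    unfolding bounded_iff by blast
  show "\<exists>M. \<forall>x\<in>{a..b}. \<forall>y\<in>{a..b}. norm (f x * g x - f y * g y) \<le> M * (norm (f x - f y) + norm (g x - g y))"
  proof (intro exI ballI)
    fix x y assume x: "x \<in> {a..b}" and y: "y \<in> {a..b}"
    have "norm (f x * g x - f y * g y) = norm ((f x - f y) * g x + f y * (g x - g y))"
      by (simp add: algebra_simps)
    also have "\<dots> \<le> norm (f x - f y) * norm (g x) + norm (f y) * norm (g x - g y)"
      by (rule order_trans[OF norm_triangle_ineq add_mono[OF norm_mult_ineq norm_mult_ineq]])
    also have "\<dots> \<le> norm (f x - f y) * max B1 B2 + max B1 B2 * norm (g x - g y)"
    proof (intro add_mono mult_left_mono mult_right_mono)
      show "norm (g x) \<le> max B1 B2" "norm (f y) \<le> max B1 B2"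
        using B1 B2 x y by (simp_all add: le_max_iff_disj)
    qed auto
    finally show "norm (f x * g x - f y * g y) \<le> max B1 B2 * (norm (f x - f y) + norm (g x - g y))"
      by (simp add: algebra_simps)
  qed
qed

lemma AC_loc_inverse:
  fixes f :: "real \<Rightarrow> 'a::real_normed_field"
  assumes f: "AC_loc f" and nz: "\<And>x. f x \<noteq> 0"
  shows "AC_loc (\<lambda>x. inverse (f x))"
proof (rule AC_loc_dominated[OF f])
  fix a b :: real
  have "continuous_on {a..b} (\<lambda>x. inverse (f x))"
    using nz by (intro continuous_intros continuous_on_subset[OF AC_loc_continuous[OF f]]) auto
  then have "bounded ((\<lambda>x. inverse (f x)) ` {a..b})"
    by (intro compact_imp_bounded compact_continuous_image) auto
  then obtain B where B: "\<And>x. x \<in> {a..b} \<Longrightarrow> norm (inverse (f x)) \<le> B"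
    unfolding bounded_iff by blast
  show "\<exists>M. \<forall>x\<in>{a..b}. \<forall>y\<in>{a..b}. norm (inverse (f x) - inverse (f y)) \<le> M * norm (f x - f y)"
  proof (intro exI ballI)
    fix x y assume x: "x \<in> {a..b}" and y: "y \<in> {a..b}"
    have "norm (inverse (f x) - inverse (f y)) = norm (inverse (f x)) * norm (inverse (f y)) * norm (f x - f y)"
      using nz[of x] nz[of y] by (simp add: division_ring_inverse_diff norm_mult norm_minus_commute norm_inverse)
    also have "\<dots> \<le> B * B * norm (f x - f y)"
      using B[OF x] B[OF y] by (intro mult_right_mono mult_mono) (auto intro: order_trans[OF norm_ge_zero])
    finally show "norm (inverse (f x) - inverse (f y)) \<le> B * B * norm (f x - f y)" .
  qed
qed

lemma AC_loc_id: "AC_loc (\<lambda>x::real. x)"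
  unfolding AC_loc_def
proof (intro allI impI)
  fix a b e :: real assume "e > 0"
  show "\<exists>d>0. \<forall>(n::nat) (I :: nat \<Rightarrow> real \<times> real).
      (\<forall>k<n. a \<le> fst (I k) \<and> fst (I k) \<le> snd (I k) \<and> snd (I k) \<le> b) \<and>
      (\<forall>j<n. \<forall>k<n. j \<noteq> k \<longrightarrow> {fst (I j)<..<snd (I j)} \<inter> {fst (I k)<..<snd (I k)} = {}) \<and>
      (\<Sum>k<n. snd (I k) - fst (I k)) < d
      \<longrightarrow> (\<Sum>k<n. norm (snd (I k) - fst (I k))) < e"
    by (intro exI[of _ e] conjI \<open>e > 0\<close> allI impI) simp
qed

text \<open>The derivative is bounded on compact intervals, so the function is Lipschitz there. It
  serves as integrating factor in \<open>hom_sol_zero\<close>.\<close>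

lemma AC_loc_exp: "AC_loc (\<lambda>x. exp (c * x) :: real)"
proof (rule AC_loc_dominated[OF AC_loc_id])
  fix a b :: real
  show "\<exists>M. \<forall>x\<in>{a..b}. \<forall>y\<in>{a..b}. norm (exp (c * x) - exp (c * y)) \<le> M * norm (x - y)"
  proof (intro exI ballI)
    fix x y assume x: "x \<in> {a..b}" and y: "y \<in> {a..b}"
    show "norm (exp (c * x) - exp (c * y)) \<le> (\<bar>c\<bar> * exp (\<bar>c\<bar> * max \<bar>a\<bar> \<bar>b\<bar>)) * norm (x - y)"
    proof (rule field_differentiable_bound[of "{a..b}" _ "\<lambda>x. c * exp (c * x)"])
      fix t assume t: "t \<in> {a..b}"
      have "c * t \<le> \<bar>c\<bar> * \<bar>t\<bar>" by (metis abs_ge_self abs_mult)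
      also have "\<dots> \<le> \<bar>c\<bar> * max \<bar>a\<bar> \<bar>b\<bar>" using t by (intro mult_left_mono) auto
      finally show "norm (c * exp (c * t)) \<le> \<bar>c\<bar> * exp (\<bar>c\<bar> * max \<bar>a\<bar> \<bar>b\<bar>)"
        by (simp add: abs_mult mult_left_mono)
    qed (use x y in \<open>auto intro!: derivative_eq_intros\<close>)
  qed
qed

text \<open>The difference f b - f a is a sum over a fine tagged division. The intervals tagged in the
  exceptional null set lie in an open set of small measure and are handled by absolute
  continuity, the others by the sign of the derivative.\<close>

lemma AC_loc_mono:
  fixes f :: "real \<Rightarrow> real"
  assumes f: "AC_loc f"
    and ae: "AE x in lebesgue. \<exists>d\<ge>0. (f has_vector_derivative d) (at x)"
    and ab: "a \<le> b"
  shows "f a \<le> f b"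
proof -
  define N where "N = {x. \<not> (\<exists>d\<ge>0. (f has_vector_derivative d) (at x))}"
  have N0: "N \<in> null_sets lebesgue"
    using ae unfolding N_def by (auto simp: eventually_ae_filter completion.complete2)
  \<comment> \<open>The intervals tagged in \<open>N\<close> cost at most \<open>e\<close>, the
    others at most \<open>e * (b - a)\<close>; since \<open>e\<close> is arbitrary, \<open>f\<close>
    cannot decrease.\<close>
  have est: "f a - f b \<le> e * (1 + (b - a))" if "e > 0" for e
  proof -
    obtain d where "d > 0" and d: "\<And>(n::nat) I. (\<And>k. k < n \<Longrightarrow> a \<le> fst (I k) \<and> fst (I k) \<le> snd (I k) \<and> snd (I k) \<le> b) \<Longrightarrow>
      (\<And>j k. j < n \<Longrightarrow> k < n \<Longrightarrow> j \<noteq> k \<Longrightarrow> {fst (I j)<..<snd (I j)} \<inter> {fst (I k)<..<snd (I k)} = {}) \<Longrightarrow>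
      (\<Sum>k<n. snd (I k) - fst (I k)) < d \<Longrightarrow>
      (\<Sum>k<n. norm (f (snd (I k)) - f (fst (I k)))) < e"
      using AC_locD[OF f \<open>e > 0\<close>] by blast
    obtain U where U: "open U" "N \<subseteq> U" "U - N \<in> lmeasurable" "emeasure lebesgue (U - N) < ennreal d"
      using sets_lebesgue_outer_open[of N d] N0 \<open>d > 0\<close> by auto
    have Um: "emeasure lebesgue U < ennreal d"
      using U N0 by (metis emeasure_Diff_null_set borel_open sets_completionI_sets sets_lborel)
    \<comment> \<open>A nonnegative derivative, with slope error \<open>e\<close>, bounds increments
      below by \<open>- e\<close> times the length. Both sides of \<open>x\<close> are recorded
      because a tag may lie inside its interval.\<close>
    have "\<exists>r>0. \<forall>y. \<bar>y - x\<bar> < r \<longrightarrow> (y \<ge> x \<longrightarrow> f y - f x \<ge> - e * (y - x)) \<and> (y \<le> x \<longrightarrow> f x - f y \<ge> - e * (x - y))"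
      if "x \<notin> N" for x
    proof -
      from that obtain d' where "d' \<ge> 0" "(f has_vector_derivative d') (at x)" by (auto simp: N_def)
      then obtain r where r: "r > 0" "\<And>y. norm (y - x) < r \<Longrightarrow> norm (f y - f x - (y - x) * d') \<le> e * norm (y - x)"
        using \<open>e > 0\<close> by (auto simp: has_vector_derivative_def has_derivative_at_alt)
      show ?thesis
      proof (intro exI[of _ r] conjI allI impI)
        fix y assume y: "\<bar>y - x\<bar> < r"
        have b: "\<bar>f y - f x - (y - x) * d'\<bar> \<le> e * \<bar>y - x\<bar>" using r(2)[of y] y by simp
        { assume "y \<ge> x"
          then have "(y - x) * d' \<ge> 0" using \<open>d' \<ge> 0\<close> by simp
          then show "f y - f x \<ge> - e * (y - x)" using b \<open>y \<ge> x\<close> by (auto simp: abs_if algebra_simps split: if_splits) }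
        { assume "y \<le> x"
          then have "(x - y) * d' \<ge> 0" using \<open>d' \<ge> 0\<close> by simp
          then show "f x - f y \<ge> - e * (x - y)" using b \<open>y \<le> x\<close> by (auto simp: abs_if algebra_simps split: if_splits) }
      qed (fact r)
    qed
    then obtain r where r0: "\<And>x. x \<notin> N \<Longrightarrow> r x > 0" and
      r: "\<And>x y. x \<notin> N \<Longrightarrow> \<bar>y - x\<bar> < r x \<Longrightarrow> (y \<ge> x \<longrightarrow> f y - f x \<ge> - e * (y - x)) \<and> (y \<le> x \<longrightarrow> f x - f y \<ge> - e * (x - y))"
      by metis
    define \<gamma> where "\<gamma> x = (if x \<in> N then U else ball x (r x))" for x
    have "gauge \<gamma>"
      unfolding gauge_def \<gamma>_def using U r0 by auto
    then obtain p where p: "p tagged_division_of {a..b}" "\<gamma> fine p"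
      by (rule fine_division_exists_real)
    have fin: "finite p" using p by auto
    define pN where "pN = {t \<in> p. fst t \<in> N}"
    have finN: "finite pN" using fin by (simp add: pN_def)
    have K: "K = {Inf K..Sup K} \<and> Inf K \<le> x \<and> x \<le> Sup K \<and> a \<le> Inf K \<and> Sup K \<le> b \<and> K \<subseteq> \<gamma> x" if "(x, K) \<in> p" for x K
    proof -
      from that p(1) obtain c d where cd: "K = {c..d}" by (metis box_real(2) tagged_division_ofD(4))
      moreover have "x \<in> K" "K \<subseteq> {a..b}" using that p(1) by auto
      moreover have "K \<subseteq> \<gamma> x" using that p(2) by (auto simp: fine_def)
      ultimately show ?thesis by auto
    qed
    define L where "L t = (Inf (snd t :: real set), Sup (snd t))" for t :: "real \<times> real set"
    have disj: "{fst (L s)<..<snd (L s)} \<inter> {fst (L t)<..<snd (L t)} = {}" if "s \<in> p" "t \<in> p" "s \<noteq> t" for s t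
    proof -
      have "interior (snd s) \<inter> interior (snd t) = {}"
        using tagged_division_ofD(5)[OF p(1), of "fst s" "snd s" "fst t" "snd t"] that by simp
      moreover have "interior (snd s) = {fst (L s)<..<snd (L s)}" "interior (snd t) = {fst (L t)<..<snd (L t)}"
        using K[of "fst s" "snd s"] K[of "fst t" "snd t"] that unfolding L_def
        by (metis fst_conv interior_atLeastAtMost_real prod.collapse snd_conv)+
      ultimately show ?thesis by simp
    qed
    have sumL: "(\<Sum>t\<in>pN. snd (L t) - fst (L t)) < d"
    proof -
      have "(\<Sum>t\<in>pN. snd (L t) - fst (L t)) = (\<Sum>t\<in>pN. measure lebesgue {fst (L t)<..<snd (L t)})"
      proof (rule sum.cong[OF refl])
        fix t assume "t \<in> pN"
        then show "snd (L t) - fst (L t) = measure lebesgue {fst (L t)<..<snd (L t)}"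
          using K[of "fst t" "snd t"] by (simp add: pN_def L_def)
      qed
      also have "\<dots> = measure lebesgue (\<Union>t\<in>pN. {fst (L t)<..<snd (L t)})"
      proof (rule measure_finite_Union[symmetric, OF finN])
        show "disjoint_family_on (\<lambda>t. {fst (L t)<..<snd (L t)}) pN"
          using disj by (auto simp: disjoint_family_on_def pN_def)
        show "emeasure lebesgue {fst (L t)<..<snd (L t)} \<noteq> \<infinity>" for t
          by (cases "fst (L t) \<le> snd (L t)") auto
      qed auto
      also have "\<dots> \<le> measure lebesgue U"
      proof (rule measure_mono_fmeasurable)
        show "(\<Union>t\<in>pN. {fst (L t)<..<snd (L t)}) \<subseteq> U"
        proof (rule UN_least)
          fix t assume "t \<in> pN"
          then have "snd t \<subseteq> U" "snd t = {fst (L t)..snd (L t)}"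
            using K[of "fst t" "snd t"] by (auto simp: pN_def L_def \<gamma>_def)
          then show "{fst (L t)<..<snd (L t)} \<subseteq> U"
            by (metis greaterThanLessThan_subseteq_atLeastAtMost_iff order_refl subset_trans)
        qed
        show "(\<Union>t\<in>pN. {fst (L t)<..<snd (L t)}) \<in> sets lebesgue" 
          using finN by (intro sets.finite_UN) auto
        show "U \<in> lmeasurable" using U(1) less_trans[OF Um ennreal_less_top] by (intro fmeasurableI) auto
      qed
      also have "\<dots> < d"
      proof -
        have "emeasure lebesgue U = ennreal (measure lebesgue U)"
          using less_trans[OF Um ennreal_less_top] by (intro emeasure_eq_ennreal_measure) auto
        then show ?thesis using Um by (metis ennreal_less_iff measure_nonneg)
      qed
      finally show ?thesis .
    qed
    have "(\<Sum>t\<in>pN. norm (f (snd (L t)) - f (fst (L t)))) < e"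
    proof -
      \<comment> \<open>Absolute continuity speaks of families indexed by natural numbers, so the
        finite set \<open>pN\<close> is enumerated.\<close>
      from ex_bij_betw_nat_finite[OF finN] obtain h where h: "bij_betw h {0..<card pN} pN" by blast
      then have h': "bij_betw h {..<card pN} pN" by (simp add: atLeast0LessThan)
      have inp: "h k \<in> p" if "k < card pN" for k using bij_betwE[OF h'] that pN_def by blast
      have "(\<Sum>k<card pN. norm (f (snd (L (h k))) - f (fst (L (h k))))) < e"
      proof (rule d)
        fix k assume "k < card pN"
        then show "a \<le> fst (L (h k)) \<and> fst (L (h k)) \<le> snd (L (h k)) \<and> snd (L (h k)) \<le> b"
          using K[of "fst (h k)" "snd (h k)"] inp by (auto simp: L_def)
      next
        fix j k assume "j < card pN" "k < card pN" "j \<noteq> k"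
        moreover from this have "h j \<noteq> h k" using inj_on_eq_iff[OF bij_betw_imp_inj_on[OF h']] by simp
        ultimately show "{fst (L (h j))<..<snd (L (h j))} \<inter> {fst (L (h k))<..<snd (L (h k))} = {}"
          using disj inp by blast
      next
        show "(\<Sum>k<card pN. snd (L (h k)) - fst (L (h k))) < d"
          using sumL sum.reindex_bij_betw[OF h', of "\<lambda>t. snd (L t) - fst (L t)"] by simp
      qed
      then show ?thesis
        using sum.reindex_bij_betw[OF h', of "\<lambda>t. norm (f (snd (L t)) - f (fst (L t)))"] by simp
    qed
    then have SN: "(\<Sum>t\<in>pN. f (snd (L t)) - f (fst (L t))) \<ge> - e"
      using sum_norm_le[of pN "\<lambda>t. f (snd (L t)) - f (fst (L t))" "\<lambda>t. norm (f (snd (L t)) - f (fst (L t)))"]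
      by (simp add: abs_le_iff)
    have "(\<Sum>t\<in>p - pN. f (snd (L t)) - f (fst (L t))) \<ge> (\<Sum>t\<in>p - pN. - e * (snd (L t) - fst (L t)))"
    proof (rule sum_mono)
      fix t assume t: "t \<in> p - pN"
      define x I S where "x = fst t" and "I = Inf (snd t)" and "S = Sup (snd t)"
      have "x \<notin> N" "I \<le> x" "x \<le> S" "{I..S} \<subseteq> ball x (r x)"
        using t K[of "fst t" "snd t"] by (auto simp: pN_def \<gamma>_def x_def I_def S_def)
      moreover from this have "I \<in> ball x (r x)" "S \<in> ball x (r x)"
        by (meson atLeastAtMost_iff order.refl order_trans subsetD)+
      then have "\<bar>I - x\<bar> < r x" "\<bar>S - x\<bar> < r x"
        by (auto simp: dist_real_def abs_minus_commute)
      ultimately have "f S - f x \<ge> - e * (S - x)" "f x - f I \<ge> - e * (x - I)"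
        using r by blast+
      then show "- e * (snd (L t) - fst (L t)) \<le> f (snd (L t)) - f (fst (L t))"
        by (simp add: L_def I_def S_def algebra_simps)
    qed
    \<comment> \<open>The added terms are nonpositive, so the lower bound may be taken over the
      whole division, where the lengths add up to \<open>b - a\<close>.\<close>
    moreover have "(\<Sum>t\<in>p - pN. - e * (snd (L t) - fst (L t))) \<ge> (\<Sum>t\<in>p. - e * (snd (L t) - fst (L t)))"
    proof -
      have "(\<Sum>t\<in>p - pN. e * (snd (L t) - fst (L t))) \<le> (\<Sum>t\<in>p. e * (snd (L t) - fst (L t)))"
      proof (rule sum_mono2[OF fin])
        fix t assume "t \<in> p - (p - pN)"
        then show "0 \<le> e * (snd (L t) - fst (L t))"
          using K[of "fst t" "snd t"] \<open>e > 0\<close> by (simp add: L_def)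
      qed auto
      then show ?thesis by (simp add: sum_negf)
    qed
    moreover have "(\<Sum>t\<in>p. - e * (snd (L t) - fst (L t))) = - e * (b - a)"
      using additive_tagged_division_1[OF ab p(1), of "\<lambda>x. x"] 
      by (simp add: sum_distrib_left[symmetric] L_def case_prod_unfold sum_negf)
    moreover have "f b - f a = (\<Sum>t\<in>p. f (snd (L t)) - f (fst (L t)))"
      using additive_tagged_division_1[OF ab p(1), of f] by (simp add: L_def case_prod_unfold)
    moreover have "\<dots> = (\<Sum>t\<in>p - pN. f (snd (L t)) - f (fst (L t))) + (\<Sum>t\<in>pN. f (snd (L t)) - f (fst (L t)))"
      using fin by (intro sum.subset_diff) (auto simp: pN_def)
    ultimately show ?thesis using SN by (simp add: algebra_simps)
  qed
  have "f a - f b \<le> 0"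
  proof (rule field_le_epsilon)
    fix e :: real assume "e > 0"
    moreover have "1 + (b - a) > 0" using ab by simp
    ultimately show "f a - f b \<le> 0 + e" using est[of "e / (1 + (b - a))"] by simp
  qed
  then show ?thesis by simp
qed

text \<open>\<open>AC_loc_mono\<close> applies to the real and imaginary parts and to their
  negatives.\<close>

lemma AC_loc_const:
  fixes f :: "real \<Rightarrow> complex"
  assumes f: "AC_loc f"
    and ae: "AE x in lebesgue. (f has_vector_derivative 0) (at x)"
  shows "f x = f y"
proof -
  have const: "T (f x) = T (f y)" if T: "bounded_linear (T :: complex \<Rightarrow> real)" for T x y
  proof -
    have le: "T' (f x) \<le> T' (f y)" if "x \<le> y" "bounded_linear T'" for T' :: "complex \<Rightarrow> real" and x y
    proof (rule AC_loc_mono[of "\<lambda>x. T' (f x)", OF AC_loc_bounded_linear[OF that(2) f] _ that(1)])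
      interpret bounded_linear T' by fact
      show "AE x in lebesgue. \<exists>d\<ge>0. ((\<lambda>x. T' (f x)) has_vector_derivative d) (at x)"
        using ae by eventually_elim (metis has_vector_derivative order_refl zero)
    qed
    have "T (f x) = T (f y)" if "x \<le> y" for x y
      using le[OF that T] le[OF that bounded_linear_minus[OF T]] by simp
    then show ?thesis by (metis linear)
  qed
  show ?thesis
    using const[OF bounded_linear_Re] const[OF bounded_linear_Im] by (simp add: complex_eq_iff)
qed

section \<open>The Darboux matrix\<close>

lemma fst_csmul [simp]: "fst (csmul c p) = c * fst p"
  and snd_csmul [simp]: "snd (csmul c p) = c * snd p"
  by (simp_all add: csmul_def)

lemma csmul_zero [simp]: "csmul c 0 = 0"
  by (simp add: prod_eq_iff)

lemma norm_csmul: "norm (csmul c p) = norm c * norm p"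
  by (cases p) (simp add: csmul_def norm_Pair norm_mult power_mult_distrib real_sqrt_mult flip: distrib_left)

definition ip :: "complex \<times> complex \<Rightarrow> complex \<times> complex \<Rightarrow> complex" where
  "ip a b = cnj (fst a) * fst b + cnj (snd a) * snd b"

text \<open>The Wronskian, with the sign for which \<open>wr a (conjK a)\<close> equals
  \<open>ip a a\<close>.\<close>

definition wr :: "complex \<times> complex \<Rightarrow> complex \<times> complex \<Rightarrow> complex" where
  "wr a b = snd a * fst b - fst a * snd b"

text \<open>The antilinear map K of the conjugation symmetry; its value is orthogonal to
  \<open>a\<close> and has the same norm.\<close>

definition conjK :: "complex \<times> complex \<Rightarrow> complex \<times> complex" where
  "conjK a = (cnj (snd a), - cnj (fst a))"

text \<open>For nonzero \<open>a\<close>, the vector orthogonal to \<open>a\<close> whose Wronskian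
  with \<open>a\<close> is 1. Along the Darboux solution it becomes the new eigenfunction.\<close>

definition dual :: "complex \<times> complex \<Rightarrow> complex \<times> complex" where
  "dual a = csmul (1 / ip a a) (conjK a)"

text \<open>Multiplication by c on the span of a and by d on its orthogonal complement.\<close>

definition mix :: "complex \<Rightarrow> complex \<Rightarrow> complex \<times> complex \<Rightarrow> complex \<times> complex \<Rightarrow> complex \<times> complex" where
  "mix c d a b = csmul d b + csmul ((c - d) * (ip a b / ip a a)) a"

text \<open>The upper right entry of the commutator \<open>i [G, \<sigma>3]\<close>, where \<open>G\<close> is multiplication by \<open>z\<close> on the span of \<open>a\<close>
  and by \<open>cnj z\<close> on its orthogonal complement.\<close>

definition pert :: "complex \<Rightarrow> complex \<times> complex \<Rightarrow> complex" where
  "pert z a = 4 * complex_of_real (Im z) * fst a * cnj (snd a) / ip a a"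

lemma ip_self: "ip a a = complex_of_real ((norm a)\<^sup>2)"
proof -
  have "ip a a = complex_of_real ((norm (fst a))\<^sup>2 + (norm (snd a))\<^sup>2)"
    unfolding ip_def of_real_add complex_norm_square by (simp add: mult.commute)
  then show ?thesis by (simp add: norm_prod_def)
qed

lemma ip_self_eq_0_iff [simp]: "ip a a = 0 \<longleftrightarrow> a = 0"
  by (simp add: ip_self)

lemma norm_conjK [simp]: "norm (conjK a) = norm a"
  by (cases a) (simp add: conjK_def norm_Pair add.commute)

lemma norm_ip_le: "norm (ip a b) \<le> norm a * norm b"
proof -
  have "norm (ip a b) \<le> norm (fst a) * norm (fst b) + norm (snd a) * norm (snd b)"
    unfolding ip_def by (rule order_trans[OF norm_triangle_ineq]) (simp add: norm_mult)
  also have "\<dots> \<le> sqrt ((norm (fst a))\<^sup>2 + (norm (snd a))\<^sup>2) * sqrt ((norm (fst b))\<^sup>2 + (norm (snd b))\<^sup>2)"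
  proof -
    \<comment> \<open>Lagrange's identity; dropping the second square gives Cauchy-Schwarz.\<close>
    have "(norm (fst a) * norm (fst b) + norm (snd a) * norm (snd b))\<^sup>2 + (norm (fst a) * norm (snd b) - norm (snd a) * norm (fst b))\<^sup>2 =
      ((norm (fst a))\<^sup>2 + (norm (snd a))\<^sup>2) * ((norm (fst b))\<^sup>2 + (norm (snd b))\<^sup>2)"
      by (simp add: power2_eq_square algebra_simps)
    then have "(norm (fst a) * norm (fst b) + norm (snd a) * norm (snd b))\<^sup>2 \<le>
      ((norm (fst a))\<^sup>2 + (norm (snd a))\<^sup>2) * ((norm (fst b))\<^sup>2 + (norm (snd b))\<^sup>2)"
      by (metis le_add_same_cancel1 zero_le_power2)
    then show ?thesis by (simp add: real_le_rsqrt flip: real_sqrt_mult)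
  qed
  finally show ?thesis by (simp add: norm_prod_def)
qed

text \<open>Cauchy-Schwarz controls the projection coefficient, so the bound is uniform in
  \<open>a\<close> and the pointwise map is bounded on L2. For \<open>a = 0\<close> the map is just
  \<open>csmul d\<close>.\<close>

lemma norm_mix_le: "norm (mix c d a b) \<le> (norm d + norm (c - d)) * norm b"
proof (cases "a = 0")
  case False
  have "norm (ip a b / ip a a) * norm a = norm (ip a b) / norm a"
    using False by (simp add: norm_divide ip_self norm_power power2_eq_square del: of_real_mult)
  also have "\<dots> \<le> norm b"
    using norm_ip_le[of a b] False by (simp add: field_simps)
  finally have *: "norm (ip a b / ip a a) * norm a \<le> norm b" .
  have "norm (mix c d a b) \<le> norm d * norm b + norm (c - d) * (norm (ip a b / ip a a) * norm a)"
    unfolding mix_def by (rule order_trans[OF norm_triangle_ineq]) (simp add: norm_csmul norm_mult norm_divide)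
  also have "\<dots> \<le> norm d * norm b + norm (c - d) * norm b"
    by (intro add_left_mono mult_left_mono * norm_ge_zero)
  finally show ?thesis by (simp add: algebra_simps)
qed (simp add: mix_def csmul_def norm_csmul[unfolded csmul_def] algebra_simps zero_prod_def[symmetric])

lemma ip_add: "ip a (b + b') = ip a b + ip a b'"
  by (simp add: ip_def algebra_simps)

lemma ip_csmul: "ip a (csmul c b) = c * ip a b"
  by (simp add: ip_def algebra_simps)

lemma mix_add: "mix c d a (b + b') = mix c d a b + mix c d a b'"
  by (auto simp: mix_def prod_eq_iff ip_add algebra_simps add_divide_distrib)

lemma mix_diff: "mix c d a (b - b') = mix c d a b - mix c d a b'"
  using mix_add[of c d a "b - b'" b'] by simp

lemma mix_zero [simp]: "mix c d a 0 = 0"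
  using mix_diff[of c d a 0 0] by simp

text \<open>Both maps are diagonal in the same orthogonal splitting; reciprocal coefficients
  therefore give the inverse.\<close>

lemma mix_mix:
  assumes "a \<noteq> 0"
  shows "mix c d a (mix c' d' a b) = mix (c * c') (d * d') a b"
  using assms by (simp add: mix_def prod_eq_iff ip_add ip_csmul field_simps)

lemma mix_1_1 [simp]: "mix 1 1 a b = b"
  by (simp add: mix_def prod_eq_iff)

text \<open>Expansion in the orthogonal basis \<open>a\<close>, \<open>conjK a\<close>. The second
  coefficient is a Wronskian, a quantity with a simple derivative along solutions.\<close>

lemma conjK_expand:
  assumes "a \<noteq> 0"
  shows "b = csmul (ip a b / ip a a) a + csmul (wr a b / ip a a) (conjK a)"
proof -
  have *: "ip a a \<noteq> 0" using assms by simp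
  have 1: "ip a a * fst b = ip a b * fst a + wr a b * cnj (snd a)"
    by (simp add: ip_def wr_def algebra_simps)
  have 2: "ip a a * snd b = ip a b * snd a - wr a b * cnj (fst a)"
    by (simp add: ip_def wr_def algebra_simps)
  show ?thesis
    using * 1 2 by (simp add: prod_eq_iff conjK_def field_simps)
qed

lemma mix_0_1:
  assumes "a \<noteq> 0"
  shows "mix 0 1 a b = csmul (wr a b) (dual a)"
  using conjK_expand[OF assms, of b] 
  by (auto simp: mix_def prod_eq_iff dual_def)

lemma mix_1_0: "mix 1 0 a b = csmul (ip a b / ip a a) a"
  by (simp add: mix_def prod_eq_iff)

lemma mix_sum: "mix 1 0 a b + mix 0 1 a b = b"
  by (simp add: mix_def prod_eq_iff)

lemma ip_dual: "ip (dual a) (dual a) = 1 / ip a a"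
proof (cases "a = 0")
  case False
  have c: "cnj (1 / ip a a) = 1 / ip a a" by (simp add: ip_self)
  have "ip (dual a) (dual a) = (cnj (1 / ip a a) * (1 / ip a a)) * ip (conjK a) (conjK a)"
    unfolding dual_def ip_def[of "csmul _ _"] by (simp add: ip_def[of "conjK a"] algebra_simps)
  also have "ip (conjK a) (conjK a) = ip a a"
    by (simp add: ip_self)
  finally show ?thesis using False unfolding c by simp
qed (simp add: dual_def ip_def csmul_def)

lemma dual_eq_0_iff [simp]: "dual a = 0 \<longleftrightarrow> a = 0"
  by (metis ip_dual divide_eq_0_iff ip_self_eq_0_iff zero_neq_one)

text \<open>\<open>dual a\<close> spans the orthogonal complement of \<open>a\<close>, so the
  coefficients change places. With \<open>pert_dual\<close> this makes the transformation based on
  \<open>dual\<close> the inverse one.\<close>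

lemma mix_dual:
  assumes "a \<noteq> 0"
  shows "mix c d (dual a) b = mix d c a b"
proof -
  have "ip (dual a) b = wr a b / ip a a"
    by (simp add: dual_def ip_def wr_def conjK_def diff_divide_distrib algebra_simps ip_self)
  then have "mix c d (dual a) b = csmul d b + csmul ((c - d) * wr a b / ip a a) (conjK a)"
    using assms unfolding mix_def ip_dual by (simp add: dual_def prod_eq_iff)
  also have "csmul ((c - d) * wr a b / ip a a) (conjK a) = csmul (c - d) (b - csmul (ip a b / ip a a) a)"
    using conjK_expand[OF assms, of b] by (simp add: prod_eq_iff algebra_simps)
  also have "csmul d b + \<dots> = mix d c a b"
    by (simp add: mix_def prod_eq_iff) (simp add: algebra_simps flip: diff_divide_distrib add_divide_distrib)
  finally show ?thesis .
qed

text \<open>Exchanging the two eigenspaces turns \<open>G\<close> into \<open>z + cnj z - G\<close>,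
  which reverses the sign of the commutator.\<close>

lemma pert_dual: "pert z (dual a) = - pert z a"
proof (cases "a = 0")
  case False
  have "cnj (ip a a) = ip a a" by (simp add: ip_self)
  then show ?thesis
    using False by (simp add: pert_def ip_dual) (simp add: dual_def conjK_def field_simps)
qed (simp add: pert_def dual_def csmul_def zero_prod_def)

text \<open>The inhomogeneous system corresponding to M(q) F = z F + (i h1, - i h2).\<close>

definition sys :: "(real \<Rightarrow> complex) \<Rightarrow> complex \<Rightarrow> (real \<Rightarrow> complex \<times> complex) \<Rightarrow> (real \<Rightarrow> complex \<times> complex) \<Rightarrow> real \<Rightarrow> bool"
  where "sys q z F h x \<longleftrightarrow>
    ((\<lambda>t. fst (F t)) has_vector_derivative - \<i> * z * fst (F x) + q x * snd (F x) + fst (h x)) (at x) \<and>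
    ((\<lambda>t. snd (F t)) has_vector_derivative \<i> * z * snd (F x) - cnj (q x) * fst (F x) + snd (h x)) (at x)"

lemma sys_iff_deriv:
  "sys q z F h x \<longleftrightarrow> (\<exists>d. (F has_vector_derivative d) (at x) \<and>
     fst d = - \<i> * z * fst (F x) + q x * snd (F x) + fst (h x) \<and>
     snd d = \<i> * z * snd (F x) - cnj (q x) * fst (F x) + snd (h x))" (is "?L \<longleftrightarrow> ?R")
proof
  assume ?L
  then have "((\<lambda>t. (fst (F t), snd (F t))) has_vector_derivative
      (- \<i> * z * fst (F x) + q x * snd (F x) + fst (h x), \<i> * z * snd (F x) - cnj (q x) * fst (F x) + snd (h x))) (at x)"
    unfolding sys_def by (intro has_vector_derivative_Pair) simp_all
  then show ?R by (intro exI conjI) (simp only: prod.collapse, simp_all)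
next
  assume ?R
  then obtain d where d: "(F has_vector_derivative d) (at x)"
     "fst d = - \<i> * z * fst (F x) + q x * snd (F x) + fst (h x)"
     "snd d = \<i> * z * snd (F x) - cnj (q x) * fst (F x) + snd (h x)" by blast
  then show ?L
    unfolding sys_def using bounded_linear.has_vector_derivative[OF bounded_linear_fst d(1)]
      bounded_linear.has_vector_derivative[OF bounded_linear_snd d(1)] by simp
qed

section \<open>Operations on the inhomogeneous system\<close>

lemma sys_add: "sys q z F h x \<Longrightarrow> sys q z G k x \<Longrightarrow> sys q z (\<lambda>t. F t + G t) (\<lambda>t. h t + k t) x"
  unfolding sys_def by (auto intro!: derivative_eq_intros simp: algebra_simps)

lemma sys_csmul: "sys q z F h x \<Longrightarrow> sys q z (\<lambda>t. csmul c (F t)) (\<lambda>t. csmul c (h t)) x"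
  unfolding sys_def by (auto intro!: derivative_eq_intros simp: algebra_simps)

lemma sys_conjK:
  assumes "sys q z F h x"
  shows "sys q (cnj z) (\<lambda>t. conjK (F t)) (\<lambda>t. conjK (h t)) x"
  using assms unfolding sys_def conjK_def by (auto intro!: derivative_eq_intros)

text \<open>A change of potential is absorbed into the source term; this is how the two potentials
  are compared at \<open>z1\<close>.\<close>

lemma sys_shift:
  "sys (\<lambda>t. q t + k t) z F h x \<longleftrightarrow> sys q z F (\<lambda>t. h t + (k t * snd (F t), - cnj (k t) * fst (F t))) x"
  by (simp add: sys_def algebra_simps)

text \<open>The coefficient matrix is traceless, so only the source term contributes.\<close>

lemma wr_deriv:
  assumes "sys q z \<Phi> (\<lambda>_. 0) x" "sys q z F h x"
  shows "((\<lambda>t. wr (\<Phi> t) (F t)) has_vector_derivative wr (\<Phi> x) (h x)) (at x)"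
  using assms unfolding sys_def wr_def
  by (auto intro!: derivative_eq_intros simp: algebra_simps)

text \<open>One component of the gauge identity. Conjugates are independent letters here, so that
  everything is polynomial after multiplication by \<open>n\<close>. Condition \<open>R\<close> says
  that \<open>(c, d)\<close> and \<open>(z - z1, z - z1b)\<close> are linearly dependent.\<close>

lemma darboux_identity:
  fixes u v ub vb e :: complex
  assumes R: "c * (z - z1b) = d * (z - z1)"
   and n: "n = u * ub + v * vb" and n0: "n \<noteq> 0"
   and k: "n * k = -2*e*(z1 - z1b) * u * vb"
   and \<beta>: "n * \<beta> = ub * F + vb * G"
   and \<eta>: "n * \<eta> = ub * h + vb * g"
   and B: "n * B = e * (z1b - z) * (ub * F - vb * G) + n * \<eta> + e * (z1 - z1b) * (u * ub - v * vb) * \<beta>"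
  shows "d * (- e * z * F + q * G + h) + (c - d) * (B * u + \<beta> * (- e * z1 * u + q * v)) =
    - e * z * (d * F + (c - d) * \<beta> * u) + (q + k) * (d * G + (c - d) * \<beta> * v) + (d * h + (c - d) * \<eta> * u)"
    (is "?L = ?R")
proof -
  have "n * (?L - ?R) = (c - d) * u * (n * B) + (c-d) * e * (z - z1) * u * (n * \<beta>) - (n * k) * (d * G + (c - d) * \<beta> * v) - (c - d) * u * (n * \<eta>)"
    by (simp add: algebra_simps)
  also have "\<dots> = (c - d) * u * (e * (z1b - z) * (ub * F - vb * G)) + (c - d) * u * e * (z - z1b) * (n * \<beta>) + 2*e*(z1 - z1b) * u * vb * d * G"
    unfolding B k unfolding n by (simp add: algebra_simps)
  also have "\<dots> = 2 * e * u * vb * G * (c * (z - z1b) - d * (z - z1))"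
    unfolding \<beta> by (simp add: algebra_simps)
  also have "\<dots> = 0" using R by simp
  finally show ?thesis using n0 by simp
qed


lemma ip_deriv:
  assumes "sys q z1 \<psi> (\<lambda>_. 0) x" "sys q z F h x"
  shows "((\<lambda>t. ip (\<psi> t) (F t)) has_vector_derivative
      \<i> * (cnj z1 - z) * (cnj (fst (\<psi> x)) * fst (F x) - cnj (snd (\<psi> x)) * snd (F x)) + ip (\<psi> x) (h x)) (at x)"
  using assms unfolding sys_def ip_def
  by (auto intro!: derivative_eq_intros simp: algebra_simps)

text \<open>The intertwining relation. Condition \<open>cd\<close> holds for
  \<open>c = z - z1\<close> and \<open>d = z - cnj z1\<close>; it also admits the degenerate cases
  \<open>c = 0\<close> at \<open>z = z1\<close> and \<open>d = 0\<close> at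
  \<open>z = cnj z1\<close>, where only one component survives.\<close>

lemma sys_mix:
  assumes \<psi>: "sys q z1 \<psi> (\<lambda>_. 0) x" and nz: "\<psi> x \<noteq> 0"
    and cd: "c * (z - cnj z1) = d * (z - z1)"
    and F: "sys q z F h x"
  shows "sys (\<lambda>t. q t + pert z1 (\<psi> t)) z (\<lambda>t. mix c d (\<psi> t) (F t)) (\<lambda>t. mix c d (\<psi> t) (h t)) x"
proof -
  have N: "ip (\<psi> x) (\<psi> x) \<noteq> 0" using nz by simp
  note dip = ip_deriv[OF \<psi>]
  \<comment> \<open>\<open>B\<close> is the derivative of the coefficient of \<open>F\<close> along
    \<psi>, as the quotient rule gives it.\<close>
  define B where "B = ((\<i> * (cnj z1 - z) * (cnj (fst (\<psi> x)) * fst (F x) - cnj (snd (\<psi> x)) * snd (F x)) + ip (\<psi> x) (h x)) * ip (\<psi> x) (\<psi> x)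
     - ip (\<psi> x) (F x) * (\<i> * (cnj z1 - z1) * (cnj (fst (\<psi> x)) * fst (\<psi> x) - cnj (snd (\<psi> x)) * snd (\<psi> x)))) / (ip (\<psi> x) (\<psi> x) * ip (\<psi> x) (\<psi> x))"
  have dB: "((\<lambda>t. ip (\<psi> t) (F t) / ip (\<psi> t) (\<psi> t)) has_vector_derivative B) (at x)"
    using has_derivative_divide'[OF dip[OF F, unfolded has_vector_derivative_def] dip[OF \<psi>, unfolded has_vector_derivative_def] N]
    unfolding has_vector_derivative_def B_def
    by (rule has_derivative_eq_rhs) (simp add: fun_eq_iff ip_def[of _ 0] scaleR_conv_of_real algebra_simps diff_divide_distrib add_divide_distrib)
  define \<beta> \<eta> k where "\<beta> = ip (\<psi> x) (F x) / ip (\<psi> x) (\<psi> x)" and "\<eta> = ip (\<psi> x) (h x) / ip (\<psi> x) (\<psi> x)"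
    and "k = pert z1 (\<psi> x)"
  define u v n where "u = fst (\<psi> x)" and "v = snd (\<psi> x)" and "n = ip (\<psi> x) (\<psi> x)"
  have n: "n = u * cnj u + v * cnj v" "n = cnj u * u + cnj v * v" by (simp_all add: n_def u_def v_def ip_def)
  have n0: "n \<noteq> 0" using N by (simp add: n_def)
  have im: "complex_of_real (Im z1) * 2 = - \<i> * (z1 - cnj z1)"
    by (simp add: complex_eq_iff)
  have k: "n * k = -2 * \<i> * (z1 - cnj z1) * u * cnj v"
  proof -
    have "n * k = 2 * (complex_of_real (Im z1) * 2) * u * cnj v"
      using n0 by (simp add: k_def pert_def flip: n_def u_def v_def)
    then show ?thesis unfolding im by simp
  qed
  have \<beta>: "n * \<beta> = cnj u * fst (F x) + cnj v * snd (F x)"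
    using n0 by (simp add: \<beta>_def flip: n_def) (simp add: ip_def u_def v_def)
  have \<eta>: "n * \<eta> = cnj u * fst (h x) + cnj v * snd (h x)"
    using n0 by (simp add: \<eta>_def flip: n_def) (simp add: ip_def u_def v_def)
  have B: "n * B = \<i> * (cnj z1 - z) * (cnj u * fst (F x) - cnj v * snd (F x)) + n * \<eta> + \<i> * (z1 - cnj z1) * (u * cnj u - v * cnj v) * \<beta>"
  proof -
    have "n * B = ((\<i> * (cnj z1 - z) * (cnj u * fst (F x) - cnj v * snd (F x)) + n * \<eta>) * n
     - n * \<beta> * (\<i> * (cnj z1 - z1) * (cnj u * u - cnj v * v))) / n"
      using n0 by (simp add: B_def \<eta>_def \<beta>_def flip: n_def u_def v_def)
    also have "\<dots> = (\<i> * (cnj z1 - z) * (cnj u * fst (F x) - cnj v * snd (F x)) + n * \<eta>)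
     - \<beta> * (\<i> * (cnj z1 - z1) * (cnj u * u - cnj v * v))"
      using n0 by (simp add: diff_divide_distrib)
    finally show ?thesis by (simp add: algebra_simps)
  qed
  have kc: "n * cnj k = -2 * \<i> * (z1 - cnj z1) * cnj u * v"
    using arg_cong[OF k, of cnj] by (simp add: n_def ip_self algebra_simps)
  have eq1: "d * (- \<i> * z * fst (F x) + q x * snd (F x) + fst (h x)) + (c - d) * (B * u + \<beta> * (- \<i> * z1 * u + q x * v)) =
    - \<i> * z * (d * fst (F x) + (c - d) * \<beta> * u) + (q x + k) * (d * snd (F x) + (c - d) * \<beta> * v) + (d * fst (h x) + (c - d) * \<eta> * u)"
    by (rule darboux_identity[OF cd n(1) n0 k \<beta> \<eta> B])
  \<comment> \<open>The second row is the same identity with the components exchanged and \<i>,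
    \<open>q\<close>, \<open>k\<close> replaced by \<open>- \<i>\<close>, \<open>- cnj q\<close>,
    \<open>- cnj k\<close>.\<close>
  have eq2: "d * (- (- \<i>) * z * snd (F x) + (- cnj (q x)) * fst (F x) + snd (h x)) + (c - d) * (B * v + \<beta> * (- (- \<i>) * z1 * v + (- cnj (q x)) * u)) =
    - (- \<i>) * z * (d * snd (F x) + (c - d) * \<beta> * v) + (- cnj (q x) + (- cnj k)) * (d * fst (F x) + (c - d) * \<beta> * u) + (d * snd (h x) + (c - d) * \<eta> * v)"
  proof (rule darboux_identity[OF cd _ n0])
    show "n = v * cnj v + u * cnj u" using n by simp
    show "n * - cnj k = - 2 * - \<i> * (z1 - cnj z1) * v * cnj u" using kc by simp
    show "n * \<beta> = cnj v * snd (F x) + cnj u * fst (F x)" using \<beta> by simp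
    show "n * \<eta> = cnj v * snd (h x) + cnj u * fst (h x)" using \<eta> by simp
    show "n * B = - \<i> * (cnj z1 - z) * (cnj v * snd (F x) - cnj u * fst (F x)) + n * \<eta> + - \<i> * (z1 - cnj z1) * (v * cnj v - u * cnj u) * \<beta>"
      unfolding B by (simp add: algebra_simps)
  qed
  define bf where "bf t = ip (\<psi> t) (F t) / ip (\<psi> t) (\<psi> t)" for t
  have mix: "mix c d (\<psi> t) (F t) = csmul d (F t) + csmul ((c - d) * bf t) (\<psi> t)" for t
    by (simp add: mix_def bf_def)
  have dB': "(bf has_vector_derivative B) (at x)" using dB by (simp add: bf_def[abs_def])
  have \<beta>: "bf x = \<beta>" by (simp add: bf_def \<beta>_def)
  have mixh: "mix c d (\<psi> x) (h x) = csmul d (h x) + csmul ((c - d) * \<eta>) (\<psi> x)"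
    by (simp add: mix_def \<eta>_def)
  have "((\<lambda>t. fst (mix c d (\<psi> t) (F t))) has_vector_derivative
     d * (- \<i> * z * fst (F x) + q x * snd (F x) + fst (h x)) + (c - d) * (B * u + \<beta> * (- \<i> * z1 * u + q x * v))) (at x)"
    using F \<psi> dB' unfolding sys_def mix
    by (auto intro!: derivative_eq_intros simp: u_def v_def \<beta> algebra_simps)
  moreover have "((\<lambda>t. snd (mix c d (\<psi> t) (F t))) has_vector_derivative
     d * (- (- \<i>) * z * snd (F x) + (- cnj (q x)) * fst (F x) + snd (h x)) + (c - d) * (B * v + \<beta> * (- (- \<i>) * z1 * v + (- cnj (q x)) * u))) (at x)"
    using F \<psi> dB' unfolding sys_def mix
    by (auto intro!: derivative_eq_intros simp: u_def v_def \<beta> algebra_simps)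
  ultimately show ?thesis
    unfolding sys_def eq1 eq2 mix mixh \<beta> k_def[symmetric]
    by (simp flip: u_def v_def) (simp add: algebra_simps)
qed

section \<open>The spectra in terms of the inhomogeneous system\<close>

lemma L2_dominated:
  assumes "F \<in> borel_measurable lebesgue" "L2 G" "AE x in lebesgue. norm (F x) \<le> C * norm (G x)" "C \<ge> 0"
  shows "L2 F" and "L2norm F \<le> C * L2norm G"
proof -
  have G: "integrable lebesgue (\<lambda>x. (norm (G x))\<^sup>2)" using assms by (simp add: L2_def)
  have le: "AE x in lebesgue. (norm (F x))\<^sup>2 \<le> C\<^sup>2 * (norm (G x))\<^sup>2"
    using assms(3) by eventually_elim (metis norm_ge_zero power_mono power_mult_distrib)
  have I: "integrable lebesgue (\<lambda>x. (norm (F x))\<^sup>2)"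
  proof (rule Bochner_Integration.integrable_bound[OF integrable_mult_right[OF G, of "C\<^sup>2"]])
    show "(\<lambda>x. (norm (F x))\<^sup>2) \<in> borel_measurable lebesgue" using assms(1) by measurable
    show "AE x in lebesgue. norm ((norm (F x))\<^sup>2) \<le> norm (C\<^sup>2 * (norm (G x))\<^sup>2)"
      using le by eventually_elim simp
  qed
  show "L2 F" using I assms(1) by (simp add: L2_def)
  have "(\<integral>x. (norm (F x))\<^sup>2 \<partial>lebesgue) \<le> (\<integral>x. C\<^sup>2 * (norm (G x))\<^sup>2 \<partial>lebesgue)"
    by (rule integral_mono_AE[OF I integrable_mult_right[OF G] le])
  from real_sqrt_le_mono[OF this] show "L2norm F \<le> C * L2norm G"
    using assms(4) by (simp add: L2norm_def real_sqrt_mult)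
qed

lemma L2norm_nonneg [simp]: "L2norm F \<ge> 0"
  by (simp add: L2norm_def)

lemma L2_zero [simp]: "L2 (\<lambda>_. 0)"
  by (simp add: L2_def)

lemma L2norm_zero [simp]: "L2norm (\<lambda>_. 0) = 0"
  by (simp add: L2norm_def)

lemma L2norm_eq_0_iff:
  assumes "L2 F"
  shows "L2norm F = 0 \<longleftrightarrow> (AE x in lebesgue. F x = 0)"
  using assms by (simp add: L2_def L2norm_def integral_nonneg_eq_0_iff_AE)

text \<open>The factor 2 comes from (s + t)^2 \<le> 2 s^2 + 2 t^2; this weak triangle inequality is
  enough for boundedness and convergence to 0.\<close>

lemma L2_add:
  assumes "L2 F" "L2 G"
  shows "L2 (\<lambda>x. F x + G x)" and "L2norm (\<lambda>x. F x + G x) \<le> 2 * (L2norm F + L2norm G)"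
proof -
  have le: "(norm (F x + G x))\<^sup>2 \<le> 2 * (norm (F x))\<^sup>2 + 2 * (norm (G x))\<^sup>2" for x
  proof -
    have "(norm (F x + G x))\<^sup>2 \<le> (norm (F x) + norm (G x))\<^sup>2"
      by (intro power_mono norm_triangle_ineq norm_ge_zero)
    also have "\<dots> \<le> 2 * (norm (F x))\<^sup>2 + 2 * (norm (G x))\<^sup>2"
      using zero_le_power2[of "norm (F x) - norm (G x)"] by (simp add: power2_eq_square algebra_simps)
    finally show ?thesis .
  qed
  have F: "integrable lebesgue (\<lambda>x. (norm (F x))\<^sup>2)" and G: "integrable lebesgue (\<lambda>x. (norm (G x))\<^sup>2)"
    and m: "F \<in> borel_measurable lebesgue" "G \<in> borel_measurable lebesgue"
    using assms by (simp_all add: L2_def)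
  have FG: "integrable lebesgue (\<lambda>x. 2 * (norm (F x))\<^sup>2 + 2 * (norm (G x))\<^sup>2)"
    using F G by simp
  have I: "integrable lebesgue (\<lambda>x. (norm (F x + G x))\<^sup>2)"
    using m le by (intro Bochner_Integration.integrable_bound[OF FG]) auto
  show "L2 (\<lambda>x. F x + G x)" using I m by (simp add: L2_def)
  have "(L2norm (\<lambda>x. F x + G x))\<^sup>2 \<le> 2 * (L2norm F)\<^sup>2 + 2 * (L2norm G)\<^sup>2"
    using integral_mono[OF I FG le] F G by (simp add: L2norm_def)
  also have "\<dots> \<le> (2 * (L2norm F + L2norm G))\<^sup>2"
    by (simp add: power2_eq_square algebra_simps)
  finally show "L2norm (\<lambda>x. F x + G x) \<le> 2 * (L2norm F + L2norm G)"
    by (rule power2_le_imp_le) simp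
qed

lemma borel_measurable_fst_snd:
  fixes F :: "'a \<Rightarrow> complex \<times> complex"
  assumes "F \<in> borel_measurable M"
  shows "(\<lambda>x. fst (F x)) \<in> borel_measurable M" and "(\<lambda>x. snd (F x)) \<in> borel_measurable M"
  using measurable_compose[OF assms borel_measurable_continuous_onI[of fst]]
    measurable_compose[OF assms borel_measurable_continuous_onI[of snd]]
  by (simp_all add: continuous_on_fst continuous_on_snd)

lemma borel_measurable_csmul:
  assumes "c \<in> borel_measurable M" "F \<in> borel_measurable M"
  shows "(\<lambda>x. csmul (c x) (F x)) \<in> borel_measurable M"
  unfolding csmul_def
  by (intro borel_measurable_Pair borel_measurable_times borel_measurable_fst_snd assms)

lemma L2_csmul:
  assumes "L2 F"
  shows "L2 (\<lambda>x. csmul c (F x))" and "L2norm (\<lambda>x. csmul c (F x)) = norm c * L2norm F"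
proof -
  have "F \<in> borel_measurable lebesgue" using assms by (simp add: L2_def)
  then have m: "(\<lambda>x. csmul c (F x)) \<in> borel_measurable lebesgue"
    by (intro borel_measurable_csmul borel_measurable_const)
  show "L2 (\<lambda>x. csmul c (F x))"
    by (rule L2_dominated(1)[OF m assms, of "norm c"]) (auto simp: norm_csmul)
  show "L2norm (\<lambda>x. csmul c (F x)) = norm c * L2norm F"
    by (simp add: L2norm_def norm_csmul power_mult_distrib real_sqrt_mult)
qed

lemma csmul_minus_1: "csmul (-1) p = - p"
  by (simp add: csmul_def prod_eq_iff)

lemma L2_diff:
  assumes "L2 F" "L2 G"
  shows "L2 (\<lambda>x. F x - G x)" and "L2norm (\<lambda>x. F x - G x) \<le> 2 * (L2norm F + L2norm G)"
  using L2_add[OF assms(1) L2_csmul(1)[OF assms(2), of "-1"]] L2_csmul(2)[OF assms(2), of "-1"]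
  by (simp_all add: csmul_minus_1)

text \<open>F lies in the domain of D(q) and (D(q) - z) F = (i h1, - i h2).\<close>

definition Dsol :: "(real \<Rightarrow> complex) \<Rightarrow> complex \<Rightarrow> (real \<Rightarrow> complex \<times> complex) \<Rightarrow> (real \<Rightarrow> complex \<times> complex) \<Rightarrow> bool"
  where "Dsol q z F h \<longleftrightarrow> L2 F \<and> AC_loc F \<and> L2 h \<and> (AE x in lebesgue. sys q z F h x)"

text \<open>The matrix \<i> diag(1, -1) in front of the derivative in M(q). It converts a source
  term \<open>h\<close> into \<open>(D(q) - z) F\<close>, and its inverse is its negative.\<close>

definition isig :: "complex \<times> complex \<Rightarrow> complex \<times> complex" where
  "isig p = (\<i> * fst p, - \<i> * snd p)"

lemma norm_isig [simp]: "norm (isig p) = norm p"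
  by (cases p) (simp add: isig_def norm_Pair norm_mult)

lemma isig_isig: "isig (isig p) = - p"
  by (simp add: isig_def prod_eq_iff)

lemma isig_minus: "isig (- p) = - isig p"
  by (simp add: isig_def prod_eq_iff)

lemma L2_isig:
  assumes "L2 F"
  shows "L2 (\<lambda>x. isig (F x))" and "L2norm (\<lambda>x. isig (F x)) = L2norm F"
proof -
  have m: "F \<in> borel_measurable lebesgue" using assms by (simp add: L2_def)
  have "(\<lambda>x. isig (F x)) \<in> borel_measurable lebesgue"
    unfolding isig_def by (intro borel_measurable_Pair borel_measurable_times borel_measurable_const borel_measurable_fst_snd m)
  then show "L2 (\<lambda>x. isig (F x))"
    using assms by (simp add: L2_def)
  show "L2norm (\<lambda>x. isig (F x)) = L2norm F" by (simp add: L2norm_def)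
qed

text \<open>The relation M(q) F = G is solved for the derivative; \<open>z\<close> is arbitrary
  because the two terms containing it cancel.\<close>

lemma Dgraph_iff_sys:
  "(\<exists>d. (F has_vector_derivative d) (at x) \<and>
        G x = (\<i> * (fst d - q x * snd (F x)), \<i> * (- cnj (q x) * fst (F x) - snd d)))
   \<longleftrightarrow> sys q z F (\<lambda>x. - isig (G x - csmul z (F x))) x"
  unfolding sys_iff_deriv
proof (intro ex_cong1 conj_cong refl iffI conjI)
  fix d :: "complex \<times> complex"
  { assume "G x = (\<i> * (fst d - q x * snd (F x)), \<i> * (- cnj (q x) * fst (F x) - snd d))"
    then show "fst d = - \<i> * z * fst (F x) + q x * snd (F x) + fst (- isig (G x - csmul z (F x)))"
      "snd d = \<i> * z * snd (F x) - cnj (q x) * fst (F x) + snd (- isig (G x - csmul z (F x)))"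
      by (simp_all add: isig_def algebra_simps) }
  { assume d: "fst d = - \<i> * z * fst (F x) + q x * snd (F x) + fst (- isig (G x - csmul z (F x))) \<and>
      snd d = \<i> * z * snd (F x) - cnj (q x) * fst (F x) + snd (- isig (G x - csmul z (F x)))"
    show "G x = (\<i> * (fst d - q x * snd (F x)), \<i> * (- cnj (q x) * fst (F x) - snd d))"
      unfolding d[THEN conjunct1] d[THEN conjunct2] by (simp add: isig_def prod_eq_iff algebra_simps) }
qed

lemma Dsol_if_Dgraph:
  assumes "Dgraph q F G"
  shows "Dsol q z F (\<lambda>x. - isig (G x - csmul z (F x)))"
  using assms L2_csmul(1)[OF L2_isig(1)[OF L2_diff(1)[OF _ L2_csmul(1), of G F z]], of "-1"]
  unfolding Dgraph_def Dsol_def Dgraph_iff_sys[where z = z] by (simp add: csmul_minus_1)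

lemma Dgraph_if_Dsol:
  assumes "Dsol q z F h"
  shows "Dgraph q F (\<lambda>x. csmul z (F x) + isig (h x))"
  using assms L2_add(1)[OF L2_csmul(1) L2_isig(1), of F h z]
  unfolding Dgraph_def Dsol_def Dgraph_iff_sys[where z = z and G = "\<lambda>x. csmul z (F x) + isig (h x)"]
  by (simp add: isig_isig)

lemma Dsol_cong_AE:
  assumes "Dsol q z F h" "L2 k" "AE x in lebesgue. k x = h x"
  shows "Dsol q z F k"
proof -
  have "AE x in lebesgue. sys q z F h x" using assms(1) by (simp add: Dsol_def)
  with assms(3) have "AE x in lebesgue. sys q z F k x"
    by eventually_elim (simp add: sys_def)
  then show ?thesis using assms by (simp add: Dsol_def)
qed

lemma L2_Dsol: "Dsol q z F h \<Longrightarrow> L2 F" "Dsol q z F h \<Longrightarrow> L2 h" "Dsol q z F h \<Longrightarrow> AC_loc F"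
  by (simp_all add: Dsol_def)

text \<open>\<open>isig\<close> is isometric and invertible, so each of the three conditions carries
  over separately, with the same constant.\<close>

lemma resolvent_set_iff:
  "z \<in> resolvent_set q \<longleftrightarrow>
     (\<forall>F. Dsol q z F (\<lambda>_. 0) \<longrightarrow> (AE x in lebesgue. F x = 0)) \<and>
     (\<forall>h. L2 h \<longrightarrow> (\<exists>F. Dsol q z F h)) \<and>
     (\<exists>C. \<forall>F h. Dsol q z F h \<longrightarrow> L2norm F \<le> C * L2norm h)"
proof -
  have 1: "(\<forall>F G. Dgraph q F G \<and> (AE x in lebesgue. G x = csmul z (F x)) \<longrightarrow> (AE x in lebesgue. F x = 0))
     \<longleftrightarrow> (\<forall>F. Dsol q z F (\<lambda>_. 0) \<longrightarrow> (AE x in lebesgue. F x = 0))" (is "?L \<longleftrightarrow> ?R")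
  proof (intro iffI allI impI)
    fix F assume ?L "Dsol q z F (\<lambda>_. 0)"
    with Dgraph_if_Dsol[OF this(2)] show "AE x in lebesgue. F x = 0" by (auto simp: isig_def zero_prod_def[symmetric])
  next
    fix F G assume R: ?R and FG: "Dgraph q F G \<and> (AE x in lebesgue. G x = csmul z (F x))"
    have "Dsol q z F (\<lambda>_. 0)"
    proof (rule Dsol_cong_AE[OF Dsol_if_Dgraph])
      show "AE x in lebesgue. 0 = - isig (G x - csmul z (F x))"
        using FG by (auto simp: isig_def zero_prod_def[symmetric])
    qed (use FG in auto)
    then show "AE x in lebesgue. F x = 0" using R by blast
  qed
  have 2: "(\<forall>H. L2 H \<longrightarrow> (\<exists>F G. Dgraph q F G \<and> (AE x in lebesgue. G x - csmul z (F x) = H x)))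
    \<longleftrightarrow> (\<forall>h. L2 h \<longrightarrow> (\<exists>F. Dsol q z F h))" (is "?L \<longleftrightarrow> ?R")
  proof (intro iffI allI impI)
    fix h assume ?L "L2 h"
    with L2_isig(1)[OF this(2)] obtain F G where FG: "Dgraph q F G" "AE x in lebesgue. G x - csmul z (F x) = isig (h x)"
      by blast
    have "Dsol q z F h"
    proof (rule Dsol_cong_AE[OF Dsol_if_Dgraph[OF FG(1)] \<open>L2 h\<close>])
      show "AE x in lebesgue. h x = - isig (G x - csmul z (F x))"
        using FG(2) by eventually_elim (simp add: isig_isig)
    qed
    then show "\<exists>F. Dsol q z F h" by blast
  next
    fix H assume ?R "L2 H"
    with L2_csmul(1)[OF L2_isig(1)[OF this(2)], of "-1"] obtain F where "Dsol q z F (\<lambda>x. - isig (H x))"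
      by (auto simp: csmul_minus_1)
    from Dgraph_if_Dsol[OF this] show "\<exists>F G. Dgraph q F G \<and> (AE x in lebesgue. G x - csmul z (F x) = H x)"
      by (intro exI conjI) (auto simp: isig_minus isig_isig)
  qed
  have 3: "(\<forall>F G. Dgraph q F G \<longrightarrow> L2norm F \<le> C * L2norm (\<lambda>x. G x - csmul z (F x))) \<longleftrightarrow>
    (\<forall>F h. Dsol q z F h \<longrightarrow> L2norm F \<le> C * L2norm h)" (is "?L \<longleftrightarrow> ?R") for C
  proof (intro iffI allI impI)
    fix F h assume ?L "Dsol q z F h"
    then have "L2norm F \<le> C * L2norm (\<lambda>x. csmul z (F x) + isig (h x) - csmul z (F x))"
      using Dgraph_if_Dsol by blast
    then show "L2norm F \<le> C * L2norm h"
      by (simp add: L2norm_def)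
  next
    fix F G assume ?R "Dgraph q F G"
    with Dsol_if_Dgraph[OF this(2), of z] have "L2norm F \<le> C * L2norm (\<lambda>x. - isig (G x - csmul z (F x)))"
      by blast
    then show "L2norm F \<le> C * L2norm (\<lambda>x. G x - csmul z (F x))"
      by (simp add: L2norm_def)
  qed
  show ?thesis unfolding resolvent_set_def mem_Collect_eq 1 2 3 ..
qed

lemma point_spectrum_D_iff:
  "z \<in> point_spectrum_D q \<longleftrightarrow> (\<exists>F. Dsol q z F (\<lambda>_. 0) \<and> \<not> (AE x in lebesgue. F x = 0))" (is "?L \<longleftrightarrow> ?R")
proof
  assume ?L
  then obtain F G where FG: "Dgraph q F G" "\<not> (AE x in lebesgue. F x = 0)" "AE x in lebesgue. G x = csmul z (F x)"
    by (auto simp: point_spectrum_D_def)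
  have "Dsol q z F (\<lambda>_. 0)"
  proof (rule Dsol_cong_AE[OF Dsol_if_Dgraph])
    show "AE x in lebesgue. 0 = - isig (G x - csmul z (F x))"
      using FG by (auto simp: isig_def zero_prod_def[symmetric])
  qed (use FG in auto)
  then show ?R using FG by blast
next
  assume ?R
  then obtain F where F: "Dsol q z F (\<lambda>_. 0)" "\<not> (AE x in lebesgue. F x = 0)" by blast
  with Dgraph_if_Dsol[OF F(1)] show ?L
    by (auto simp: point_spectrum_D_def isig_def zero_prod_def[symmetric])
qed

text \<open>Characterizes the complement of the essential spectrum. Bounded sequences replace
  normalized ones because this form survives maps that do not preserve the norm.\<close>

definition approx_compact :: "(real \<Rightarrow> complex) \<Rightarrow> complex \<Rightarrow> bool" where
  "approx_compact q z \<longleftrightarrow> (\<forall>F h. (\<forall>n::nat. Dsol q z (F n) (h n)) \<longrightarrow> (\<exists>B. \<forall>n. L2norm (F n) \<le> B) \<longrightarrow>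
     (\<lambda>n. L2norm (h n)) \<longlonglongrightarrow> 0 \<longrightarrow>
     (\<exists>r g. strict_mono r \<and> L2 g \<and> (\<lambda>n. L2norm (\<lambda>x. F (r n) x - g x)) \<longlonglongrightarrow> 0))"

lemma approx_compactD:
  assumes "approx_compact q z" and "\<And>n. Dsol q z (F n) (h n)" and "\<And>n. L2norm (F n) \<le> B"
    and "(\<lambda>n. L2norm (h n)) \<longlonglongrightarrow> 0"
  shows "\<exists>r g. strict_mono r \<and> L2 g \<and> (\<lambda>n. L2norm (\<lambda>x. F (r n) x - g x)) \<longlonglongrightarrow> 0"
  using assms(1)[unfolded approx_compact_def, THEN spec, THEN spec, THEN mp, THEN mp, THEN mp, of F h] assms(2-4)
  by blast

lemma Dsol_csmul:
  assumes "Dsol q z F h"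
  shows "Dsol q z (\<lambda>x. csmul c (F x)) (\<lambda>x. csmul c (h x))"
proof -
  have "AC_loc (\<lambda>x. csmul c (F x))" unfolding csmul_def
    using bounded_linear_compose[OF bounded_linear_mult_right bounded_linear_fst]
      bounded_linear_compose[OF bounded_linear_mult_right bounded_linear_snd]
    by (intro AC_loc_Pair AC_loc_bounded_linear[OF _ L2_Dsol(3)[OF assms]])
  moreover have "AE x in lebesgue. sys q z (\<lambda>x. csmul c (F x)) (\<lambda>x. csmul c (h x)) x"
    using assms unfolding Dsol_def by (auto elim!: eventually_mono intro: sys_csmul)
  ultimately show ?thesis using assms by (simp add: Dsol_def L2_csmul)
qed

lemma L2norm_uminus [simp]: "L2norm (\<lambda>x. - F x) = L2norm F"
  by (simp add: L2norm_def)

text \<open>The harder direction normalizes a bounded sequence. Along a subsequence the norms tend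
  to some \<open>l\<close>; if \<open>l = 0\<close> the limit is 0, otherwise division by the norms
  leads to unit vectors as in the definition.\<close>

lemma ess_spectrum_D_iff: "z \<in> ess_spectrum_D q \<longleftrightarrow> \<not> approx_compact q z"
proof
  assume "z \<in> ess_spectrum_D q"
  then obtain f g where fg: "\<And>n. Dgraph q (f n) (g n)" "\<And>n. L2norm (f n) = 1"
      and nc: "\<not> (\<exists>r h. strict_mono r \<and> L2 h \<and> (\<lambda>n. L2norm (\<lambda>x. f (r n) x - h x)) \<longlonglongrightarrow> 0)"
      and lim: "(\<lambda>n. L2norm (\<lambda>x. g n x - csmul z (f n x))) \<longlonglongrightarrow> 0"
    unfolding ess_spectrum_D_def by blast
  have l: "L2norm (\<lambda>x. - isig (g n x - csmul z (f n x))) = L2norm (\<lambda>x. g n x - csmul z (f n x))" for n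
    by (simp add: L2norm_def)
  show "\<not> approx_compact q z"
  proof
    assume "approx_compact q z"
    then have "\<exists>r h. strict_mono r \<and> L2 h \<and> (\<lambda>n. L2norm (\<lambda>x. f (r n) x - h x)) \<longlonglongrightarrow> 0"
    proof (rule approx_compactD)
      show "Dsol q z (f n) (\<lambda>x. - isig (g n x - csmul z (f n x)))" for n
        using Dsol_if_Dgraph[OF fg(1)] .
      show "L2norm (f n) \<le> 1" for n using fg(2) by simp
      show "(\<lambda>n. L2norm (\<lambda>x. - isig (g n x - csmul z (f n x)))) \<longlonglongrightarrow> 0"
        unfolding l by (rule lim)
    qed
    with nc show False ..
  qed
next
  assume nac: "\<not> approx_compact q z"
  show "z \<in> ess_spectrum_D q"
  proof (rule ccontr)
    assume nz: "z \<notin> ess_spectrum_D q"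
    have "approx_compact q z"
      unfolding approx_compact_def
    proof (intro allI impI)
      fix F h
      assume D: "\<forall>n::nat. Dsol q z (F n) (h n)" and "\<exists>B. \<forall>n. L2norm (F n) \<le> B"
        and lim: "(\<lambda>n. L2norm (h n)) \<longlonglongrightarrow> 0"
      then obtain B where B: "\<And>n. L2norm (F n) \<le> B" by blast
      then have "\<forall>n. L2norm (F n) \<in> {0..B}" by simp
      then obtain l s where s: "strict_mono s" and l: "(\<lambda>n. L2norm (F (s n))) \<longlonglongrightarrow> l" and l0: "l \<in> {0..B}"
        using compact_Icc[of 0 B] unfolding compact_def o_def by meson
      show "\<exists>r g. strict_mono r \<and> L2 g \<and> (\<lambda>n. L2norm (\<lambda>x. F (r n) x - g x)) \<longlonglongrightarrow> 0"
      proof (cases "l = 0")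
        case True
        then show ?thesis using s l by (intro exI[of _ s] exI[of _ "\<lambda>_. 0"]) simp
      next
        case False
        then have "l > 0" using l0 by simp
        then have "\<forall>\<^sub>F n in sequentially. L2norm (F (s n)) > l / 2"
          by (intro order_tendstoD(1)[OF l]) simp
        then obtain N where N: "\<And>n. n \<ge> N \<Longrightarrow> L2norm (F (s n)) > l / 2"
          by (auto simp: eventually_sequentially)
        \<comment> \<open>The shift makes every norm exceed \<open>l / 2\<close>, so that division
          is possible at all indices.\<close>
        define t where "t n = s (n + N)" for n
        have t: "strict_mono t" using s by (simp add: t_def strict_mono_def)
        define a where "a n = L2norm (F (t n))" for n
        have a: "a n > l / 2" for n using N by (simp add: a_def t_def)
        then have a0: "a n > 0" for n using \<open>l > 0\<close> by (meson half_gt_zero less_trans)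
        have al: "a \<longlonglongrightarrow> l" using LIMSEQ_ignore_initial_segment[OF l, of N] by (simp add: a_def[abs_def] t_def)
        define f k where "f n = (\<lambda>x. csmul (1 / a n) (F (t n) x))" and "k n = (\<lambda>x. csmul (1 / a n) (h (t n) x))" for n
        have fk: "Dsol q z (f n) (k n)" for n
          using D unfolding f_def k_def by (intro Dsol_csmul) blast
        have f1: "L2norm (f n) = 1" for n
          using a0[of n] L2_csmul(2)[OF L2_Dsol(1)[OF D[rule_format, of "t n"]], of "1 / a n"]
          by (simp add: f_def norm_divide flip: a_def)
        have "(\<lambda>n. L2norm (h (t n)) / a n) \<longlonglongrightarrow> 0 / l"
          using False LIMSEQ_subseq_LIMSEQ[OF lim t] by (intro tendsto_divide al) (auto simp: o_def)
        moreover have "L2norm (k n) = L2norm (h (t n)) / a n" for n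
          using a0[of n] L2_csmul(2)[OF L2_Dsol(2)[OF D[rule_format, of "t n"]], of "1 / a n"]
          by (simp add: k_def norm_divide)
        ultimately have k0: "(\<lambda>n. L2norm (k n)) \<longlonglongrightarrow> 0" by simp
        let ?g = "\<lambda>n x. csmul z (f n x) + isig (k n x)"
        have "\<exists>r g. strict_mono r \<and> L2 g \<and> (\<lambda>n. L2norm (\<lambda>x. f (r n) x - g x)) \<longlonglongrightarrow> 0"
        proof (rule ccontr)
          assume nc: "\<not> ?thesis"
          have G: "\<forall>n. Dgraph q (f n) (?g n) \<and> L2norm (f n) = 1"
            using Dgraph_if_Dsol[OF fk] f1 by blast
          have "L2norm (\<lambda>x. ?g n x - csmul z (f n x)) = L2norm (k n)" for n
            by (simp add: L2norm_def)
          then have "(\<lambda>n. L2norm (\<lambda>x. ?g n x - csmul z (f n x))) \<longlonglongrightarrow> 0" using k0 by simp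
          with nc G have "z \<in> ess_spectrum_D q"
            unfolding ess_spectrum_D_def mem_Collect_eq by (intro exI[of _ f] exI[of _ ?g] conjI)
          with nz show False ..
        qed
        then obtain r g where r: "strict_mono r" "L2 g" and rl: "(\<lambda>n. L2norm (\<lambda>x. f (r n) x - g x)) \<longlonglongrightarrow> 0"
          by blast
        \<comment> \<open>Undoing the normalization gives the limit \<open>l\<close> times
          \<open>g\<close>, with one error from \<open>f\<close> and one from the norms
          \<open>a\<close>.\<close>
        have le: "L2norm (\<lambda>x. F (t (r n)) x - csmul l (g x)) \<le>
            2 * (a (r n) * L2norm (\<lambda>x. f (r n) x - g x) + \<bar>a (r n) - l\<bar> * L2norm g)" for n
        proof -
          have Lf: "L2 (f (r n))" using fk by (rule L2_Dsol)
          have e1: "(\<lambda>x. F (t (r n)) x - csmul l (g x)) =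
            (\<lambda>x. csmul (a (r n)) (f (r n) x - g x) + csmul (a (r n) - l) (g x))"
            using a0[of "r n"] by (simp add: f_def prod_eq_iff fun_eq_iff right_diff_distrib left_diff_distrib)
          have e2: "L2norm (\<lambda>x. csmul (a (r n)) (f (r n) x - g x) + csmul (a (r n) - l) (g x)) \<le>
              2 * (L2norm (\<lambda>x. csmul (a (r n)) (f (r n) x - g x)) + L2norm (\<lambda>x. csmul (a (r n) - l) (g x)))"
            by (intro L2_add L2_csmul L2_diff Lf r(2))
          have e3: "L2norm (\<lambda>x. csmul (a (r n)) (f (r n) x - g x)) = a (r n) * L2norm (\<lambda>x. f (r n) x - g x)"
            using a0[of "r n"] by (subst L2_csmul(2)[OF L2_diff(1)[OF Lf r(2)]]) simp
          have e4: "L2norm (\<lambda>x. csmul (a (r n) - l) (g x)) = \<bar>a (r n) - l\<bar> * L2norm g"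
            by (subst L2_csmul(2)[OF r(2)]) (simp flip: of_real_diff)
          show ?thesis using e2 unfolding e1 e3 e4 .
        qed
        have "(\<lambda>n. 2 * (a (r n) * L2norm (\<lambda>x. f (r n) x - g x) + \<bar>a (r n) - l\<bar> * L2norm g)) \<longlonglongrightarrow>
          2 * (l * 0 + \<bar>l - l\<bar> * L2norm g)"
          using LIMSEQ_subseq_LIMSEQ[OF al r(1)] unfolding o_def by (intro tendsto_intros rl)
        then have "(\<lambda>n. 2 * (a (r n) * L2norm (\<lambda>x. f (r n) x - g x) + \<bar>a (r n) - l\<bar> * L2norm g)) \<longlonglongrightarrow> 0"
          by simp
        then have "(\<lambda>n. L2norm (\<lambda>x. F (t (r n)) x - csmul l (g x))) \<longlonglongrightarrow> 0"
          by (rule tendsto_sandwich[OF _ _ tendsto_const, rotated 2])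
            (intro always_eventually allI L2norm_nonneg le)+
        then show ?thesis
          using strict_mono_o[OF t r(1)] L2_csmul(1)[OF r(2)]
          by (intro exI[of _ "t \<circ> r"] exI[of _ "\<lambda>x. csmul l (g x)"] conjI) simp_all
      qed
    qed
    with nac show False ..
  qed
qed

section \<open>Similarity by bounded maps\<close>

definition bounded_map :: "real \<Rightarrow> ((real \<Rightarrow> complex \<times> complex) \<Rightarrow> (real \<Rightarrow> complex \<times> complex)) \<Rightarrow> bool" where
  "bounded_map C T \<longleftrightarrow> C \<ge> 0 \<and> (\<forall>F. L2 F \<longrightarrow> L2 (T F) \<and> L2norm (T F) \<le> C * L2norm F) \<and>
    (\<forall>F G. T (\<lambda>x. F x - G x) = (\<lambda>x. T F x - T G x))"

lemma bounded_mapD: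
  assumes "bounded_map C T"
  shows "C \<ge> 0" "L2 F \<Longrightarrow> L2 (T F)" "L2 F \<Longrightarrow> L2norm (T F) \<le> C * L2norm F"
    "T (\<lambda>x. F x - G x) = (\<lambda>x. T F x - T G x)" "T (\<lambda>_. 0) = (\<lambda>_. 0)"
proof -
  show "C \<ge> 0" "L2 F \<Longrightarrow> L2 (T F)" "L2 F \<Longrightarrow> L2norm (T F) \<le> C * L2norm F"
    and d: "T (\<lambda>x. F x - G x) = (\<lambda>x. T F x - T G x)" for F G using assms by (auto simp: bounded_map_def)
  show "T (\<lambda>_. 0) = (\<lambda>_. 0)" using d[of "\<lambda>_. 0" "\<lambda>_. 0"] by simp
qed

text \<open>Similarity of \<open>D(q) - z\<close> and \<open>D(q') - z'\<close>. Two parameters are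
  allowed to cover the symmetry between \<open>z\<close> and \<open>cnj z\<close>; as that symmetry
  is antilinear, \<open>bounded_map\<close> asks for compatibility with differences only.\<close>

definition conjugate_at :: "(real \<Rightarrow> complex) \<Rightarrow> complex \<Rightarrow> (real \<Rightarrow> complex) \<Rightarrow> complex \<Rightarrow> bool" where
  "conjugate_at q z q' z' \<longleftrightarrow> (\<exists>T T' C C'. bounded_map C T \<and> bounded_map C' T' \<and>
     (\<forall>F. T (T' F) = F) \<and> (\<forall>F. T' (T F) = F) \<and>
     (\<forall>F h. Dsol q z F h \<longrightarrow> Dsol q' z' (T F) (T h)) \<and>
     (\<forall>F h. Dsol q' z' F h \<longrightarrow> Dsol q z (T' F) (T' h)))"

lemma conjugate_at_sym: "conjugate_at q z q' z' \<Longrightarrow> conjugate_at q' z' q z"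
  unfolding conjugate_at_def by blast

lemma conjugate_at_imp:
  assumes "conjugate_at q z q' z'"
  shows "z \<in> resolvent_set q \<Longrightarrow> z' \<in> resolvent_set q'"
    and "z \<in> point_spectrum_D q \<Longrightarrow> z' \<in> point_spectrum_D q'"
    and "approx_compact q z \<Longrightarrow> approx_compact q' z'"
proof -
  obtain T T' C C' where T: "bounded_map C T" and T': "bounded_map C' T'"
    and TT': "\<And>F. T (T' F) = F" and T'T: "\<And>F. T' (T F) = F"
    and fwd: "\<And>F h. Dsol q z F h \<Longrightarrow> Dsol q' z' (T F) (T h)"
    and bwd: "\<And>F h. Dsol q' z' F h \<Longrightarrow> Dsol q z (T' F) (T' h)"
    using assms unfolding conjugate_at_def by blast
  \<comment> \<open>These maps act on functions rather than classes; the norm bound shows that they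
    preserve vanishing almost everywhere.\<close>
  have zero: "AE x in lebesgue. S F x = 0" if "bounded_map K S" "L2 F" "AE x in lebesgue. F x = 0" for K S F
  proof -
    have "L2norm F = 0" using L2norm_eq_0_iff that by blast
    then have "L2norm (S F) = 0" using bounded_mapD(3)[OF that(1,2)] by (simp add: antisym)
    then show ?thesis using L2norm_eq_0_iff bounded_mapD(2)[OF that(1,2)] by blast
  qed
  show "z' \<in> resolvent_set q'" if z: "z \<in> resolvent_set q"
    unfolding resolvent_set_iff
  proof (intro conjI allI impI)
    fix F assume F: "Dsol q' z' F (\<lambda>_. 0)"
    from bwd[OF this] have "Dsol q z (T' F) (\<lambda>_. 0)" using bounded_mapD(5)[OF T'] by simp
    then have "AE x in lebesgue. T' F x = 0" "L2 (T' F)"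
      using z by (auto simp: resolvent_set_iff L2_Dsol)
    from zero[OF T this(2,1)] show "AE x in lebesgue. F x = 0" by (simp add: TT')
  next
    fix h assume "L2 h"
    then have "L2 (T' h)" by (rule bounded_mapD[OF T'])
    then obtain F where "Dsol q z F (T' h)" using z by (auto simp: resolvent_set_iff)
    from fwd[OF this] show "\<exists>F. Dsol q' z' F h" by (auto simp: TT')
  next
    obtain K where K: "\<And>F h. Dsol q z F h \<Longrightarrow> L2norm F \<le> K * L2norm h"
      using z by (auto simp: resolvent_set_iff)
    show "\<exists>C. \<forall>F h. Dsol q' z' F h \<longrightarrow> L2norm F \<le> C * L2norm h"
    proof (intro exI allI impI)
      fix F h assume D: "Dsol q' z' F h"
      have "L2norm F = L2norm (T (T' F))" by (simp add: TT')
      also have "\<dots> \<le> C * L2norm (T' F)"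
        by (intro bounded_mapD(3)[OF T] bounded_mapD(2)[OF T'] L2_Dsol[OF D])
      also have "L2norm (T' F) \<le> \<bar>K\<bar> * L2norm (T' h)"
        by (rule order_trans[OF K[OF bwd[OF D]] mult_right_mono]) auto
      also have "L2norm (T' h) \<le> C' * L2norm h"
        by (intro bounded_mapD(3)[OF T'] L2_Dsol[OF D])
      finally show "L2norm F \<le> (C * (\<bar>K\<bar> * C')) * L2norm h"
        by (simp add: mult_left_mono bounded_mapD(1)[OF T] mult.assoc)
    qed
  qed
  show "z' \<in> point_spectrum_D q'" if zp: "z \<in> point_spectrum_D q"
  proof -
    obtain F where F: "Dsol q z F (\<lambda>_. 0)" "\<not> (AE x in lebesgue. F x = 0)"
      using zp unfolding point_spectrum_D_iff by blast
    have "Dsol q' z' (T F) (\<lambda>_. 0)" using fwd[OF F(1)] bounded_mapD(5)[OF T] by simp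
    moreover have "\<not> (AE x in lebesgue. T F x = 0)"
      using zero[OF T', of "T F"] bounded_mapD(2)[OF T L2_Dsol(1)[OF F(1)]] F(2) by (auto simp: T'T)
    ultimately show ?thesis by (auto simp: point_spectrum_D_iff)
  qed
  show "approx_compact q' z'" if ac: "approx_compact q z"
    unfolding approx_compact_def
  proof (intro allI impI)
    fix F h
    assume D: "\<forall>n::nat. Dsol q' z' (F n) (h n)" and "\<exists>B. \<forall>n. L2norm (F n) \<le> B"
      and lim: "(\<lambda>n. L2norm (h n)) \<longlonglongrightarrow> 0"
    then obtain B where B: "\<And>n. L2norm (F n) \<le> B" by blast
    have bwdn: "Dsol q z (T' (F n)) (T' (h n))" for n using D bwd by blast
    have Bn: "L2norm (T' (F n)) \<le> C' * B" for n
      using bounded_mapD(3)[OF T' L2_Dsol(1)[OF D[rule_format, of n]]] mult_left_mono[OF B[of n] bounded_mapD(1)[OF T']] by simp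
    have limn: "(\<lambda>n. L2norm (T' (h n))) \<longlonglongrightarrow> 0"
      by (rule tendsto_sandwich[OF _ _ tendsto_const tendsto_mult_right_zero[OF lim, of C']])
        (auto intro!: always_eventually bounded_mapD(3)[OF T'] L2_Dsol(2)[OF D[rule_format]])
    obtain r g where r: "strict_mono r" "L2 g" "(\<lambda>n. L2norm (\<lambda>x. T' (F (r n)) x - g x)) \<longlonglongrightarrow> 0"
      using approx_compactD[OF ac bwdn Bn limn] by blast
    have "L2norm (\<lambda>x. F (r n) x - T g x) \<le> C * L2norm (\<lambda>x. T' (F (r n)) x - g x)" for n
    proof -
      have "(\<lambda>x. F (r n) x - T g x) = T (\<lambda>x. T' (F (r n)) x - g x)"
        by (simp add: bounded_mapD(4)[OF T] TT')
      then show ?thesis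
        using bounded_mapD(3)[OF T L2_diff(1)[OF bounded_mapD(2)[OF T' L2_Dsol(1)[OF D[rule_format, of "r n"]]] r(2)]] by simp
    qed
    then have "(\<lambda>n. L2norm (\<lambda>x. F (r n) x - T g x)) \<longlonglongrightarrow> 0"
      by (intro tendsto_sandwich[OF _ _ tendsto_const tendsto_mult_right_zero[OF r(3), of C]]) (auto intro!: always_eventually)
    then show "\<exists>r g. strict_mono r \<and> L2 g \<and> (\<lambda>n. L2norm (\<lambda>x. F (r n) x - g x)) \<longlonglongrightarrow> 0"
      by (intro exI[of _ r] exI[of _ "T g"] conjI r(1) bounded_mapD(2)[OF T r(2)])
  qed
qed

lemma conjugate_at_iff:
  assumes "conjugate_at q z q' z'"
  shows "z' \<in> spectrum_D q' \<longleftrightarrow> z \<in> spectrum_D q"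
    and "z' \<in> point_spectrum_D q' \<longleftrightarrow> z \<in> point_spectrum_D q"
    and "z' \<in> ess_spectrum_D q' \<longleftrightarrow> z \<in> ess_spectrum_D q"
proof -
  note imp = conjugate_at_imp[OF assms] and imp' = conjugate_at_imp[OF conjugate_at_sym[OF assms]]
  show "z' \<in> spectrum_D q' \<longleftrightarrow> z \<in> spectrum_D q"
    unfolding spectrum_D_def Compl_iff using imp(1) imp'(1) by blast
  show "z' \<in> point_spectrum_D q' \<longleftrightarrow> z \<in> point_spectrum_D q"
    using imp(2) imp'(2) by blast
  show "z' \<in> ess_spectrum_D q' \<longleftrightarrow> z \<in> ess_spectrum_D q"
    unfolding ess_spectrum_D_iff using imp(3) imp'(3) by blast
qed

section \<open>Darboux transformation of the operator\<close>

definition hom_sol :: "(real \<Rightarrow> complex) \<Rightarrow> complex \<Rightarrow> (real \<Rightarrow> complex \<times> complex) \<Rightarrow> bool" where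
  "hom_sol q z \<Phi> \<longleftrightarrow> AC_loc \<Phi> \<and> (AE x in lebesgue. sys q z \<Phi> (\<lambda>_. 0) x)"

lemma wave_function_iff: "wave_function q z \<Phi> \<longleftrightarrow> hom_sol q z \<Phi> \<and> (\<exists>x. \<Phi> x \<noteq> 0)"
  unfolding wave_function_def hom_sol_def sys_iff_deriv fst_zero snd_zero add_0_right by blast

lemma AC_loc_fst: "AC_loc F \<Longrightarrow> AC_loc (\<lambda>x. fst (F x))"
  and AC_loc_snd: "AC_loc F \<Longrightarrow> AC_loc (\<lambda>x. snd (F x))"
  by (erule AC_loc_bounded_linear[OF bounded_linear_fst], erule AC_loc_bounded_linear[OF bounded_linear_snd])

lemma AC_loc_cnj: "AC_loc f \<Longrightarrow> AC_loc (\<lambda>x. cnj (f x))"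
  by (rule AC_loc_bounded_linear[OF bounded_linear_cnj])

lemma AC_loc_cmult: "AC_loc f \<Longrightarrow> AC_loc (\<lambda>x. (c::complex) * f x)"
  by (rule AC_loc_bounded_linear[OF bounded_linear_mult_right])

lemmas AC_loc_intros = AC_loc_Pair AC_loc_add AC_loc_diff AC_loc_minus AC_loc_mult AC_loc_cmult AC_loc_cnj AC_loc_fst AC_loc_snd

lemma AC_loc_ip: "AC_loc F \<Longrightarrow> AC_loc G \<Longrightarrow> AC_loc (\<lambda>x. ip (F x) (G x))"
  unfolding ip_def by (intro AC_loc_intros)

lemma AC_loc_wr: "AC_loc F \<Longrightarrow> AC_loc G \<Longrightarrow> AC_loc (\<lambda>x. wr (F x) (G x))"
  unfolding wr_def by (intro AC_loc_intros)

lemma AC_loc_csmul: "AC_loc c \<Longrightarrow> AC_loc F \<Longrightarrow> AC_loc (\<lambda>x. csmul (c x) (F x))"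
  unfolding csmul_def by (intro AC_loc_intros)

lemma AC_loc_mix:
  assumes "AC_loc \<psi>" "\<And>x. \<psi> x \<noteq> 0" "AC_loc F"
  shows "AC_loc (\<lambda>x. mix c d (\<psi> x) (F x))"
proof -
  have "AC_loc (\<lambda>x. csmul d (F x))"
    unfolding csmul_def by (intro AC_loc_intros assms)
  then show ?thesis
    unfolding mix_def divide_inverse
    by (rule AC_loc_add)
      (intro AC_loc_csmul AC_loc_cmult AC_loc_mult AC_loc_inverse AC_loc_ip assms(1,3), simp add: assms(2))
qed

lemma AC_loc_measurable: "AC_loc F \<Longrightarrow> F \<in> borel_measurable lebesgue"
  by (rule measurable_completion) (simp add: borel_measurable_continuous_onI AC_loc_continuous)

lemma borel_measurable_ip:
  assumes "F \<in> borel_measurable M" "G \<in> borel_measurable M"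
  shows "(\<lambda>x. ip (F x) (G x)) \<in> borel_measurable M"
proof -
  have "continuous_on UNIV (\<lambda>w. cnj (w::complex))" by (intro continuous_intros)
  then have c: "(\<lambda>x. cnj (f x)) \<in> borel_measurable M" if "f \<in> borel_measurable M" for f
    using borel_measurable_continuous_onI measurable_compose[OF that] by blast
  show ?thesis unfolding ip_def
    by (intro borel_measurable_add borel_measurable_times c borel_measurable_fst_snd assms)
qed

lemma borel_measurable_mix:
  assumes "\<psi> \<in> borel_measurable M" "F \<in> borel_measurable M"
  shows "(\<lambda>x. mix c d (\<psi> x) (F x)) \<in> borel_measurable M"
  unfolding mix_def
  by (intro borel_measurable_add borel_measurable_csmul borel_measurable_times borel_measurable_divide
      borel_measurable_ip borel_measurable_const assms)

lemma L2_mix: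
  assumes "AC_loc \<psi>" "L2 F"
  shows "L2 (\<lambda>x. mix c d (\<psi> x) (F x))"
    and "L2norm (\<lambda>x. mix c d (\<psi> x) (F x)) \<le> (norm d + norm (c - d)) * L2norm F"
proof -
  have m: "(\<lambda>x. mix c d (\<psi> x) (F x)) \<in> borel_measurable lebesgue"
    using assms(2) by (intro borel_measurable_mix AC_loc_measurable[OF assms(1)]) (simp add: L2_def)
  show "L2 (\<lambda>x. mix c d (\<psi> x) (F x))"
    by (rule L2_dominated(1)[OF m assms(2) AE_I2[OF norm_mix_le]]) simp
  show "L2norm (\<lambda>x. mix c d (\<psi> x) (F x)) \<le> (norm d + norm (c - d)) * L2norm F"
    by (rule L2_dominated(2)[OF m assms(2) AE_I2[OF norm_mix_le]]) simp
qed

text \<open>A Gronwall argument. The potential cancels from the derivative of the squared norm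
  \<open>N\<close>, whose modulus is at most \<open>c * N\<close>. So \<open>N\<close> times
  \<open>exp (c * x)\<close> is nondecreasing, \<open>N\<close> times \<open>exp (- c * x)\<close>
  is nonincreasing, and a zero spreads in both directions.\<close>

lemma hom_sol_zero:
  assumes \<Phi>: "hom_sol q z \<Phi>" and x0: "\<Phi> x0 = 0"
  shows "\<Phi> x = 0"
proof -
  define N where "N x = Re (ip (\<Phi> x) (\<Phi> x))" for x
  have N: "N x = (norm (\<Phi> x))\<^sup>2" for x by (simp add: N_def ip_self)
  define c where "c = 2 * \<bar>Im z\<bar>"
  have AC: "AC_loc N"
    unfolding N_def using \<Phi> by (intro AC_loc_bounded_linear[OF bounded_linear_Re] AC_loc_ip) (auto simp: hom_sol_def)
  \<comment> \<open>The choice \<open>s = 1\<close> serves the points to the left of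
    \<open>x0\<close>, and \<open>s = -1\<close> those to the right.\<close>
  have mono: "s * N a * exp (s * c * a) \<le> s * N b * exp (s * c * b)" if "a \<le> b" and s: "s = 1 \<or> s = -1" for a b s :: real
  proof (rule AC_loc_mono[of "\<lambda>x. s * N x * exp (s * c * x)", OF _ _ that(1)])
    show "AC_loc (\<lambda>x. s * N x * exp (s * c * x))"
      by (rule AC_loc_mult[OF AC_loc_bounded_linear[OF bounded_linear_mult_right AC] AC_loc_exp])
    have "AE x in lebesgue. sys q z \<Phi> (\<lambda>_. 0) x" using \<Phi> by (simp add: hom_sol_def)
    then show "AE x in lebesgue. \<exists>d\<ge>0. ((\<lambda>x. s * N x * exp (s * c * x)) has_vector_derivative d) (at x)"
    proof eventually_elim
      fix x assume x: "sys q z \<Phi> (\<lambda>_. 0) x"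
      define m where "m = 2 * Im z * ((norm (fst (\<Phi> x)))\<^sup>2 - (norm (snd (\<Phi> x)))\<^sup>2)"
      have "(N has_vector_derivative Re (\<i> * (cnj z - z) * (cnj (fst (\<Phi> x)) * fst (\<Phi> x) - cnj (snd (\<Phi> x)) * snd (\<Phi> x)) + ip (\<Phi> x) 0)) (at x)"
        unfolding N_def[abs_def] by (rule bounded_linear.has_vector_derivative[OF bounded_linear_Re ip_deriv[OF x x]])
      also have "Re (\<i> * (cnj z - z) * (cnj (fst (\<Phi> x)) * fst (\<Phi> x) - cnj (snd (\<Phi> x)) * snd (\<Phi> x)) + ip (\<Phi> x) 0) = m"
        by (simp add: m_def ip_def cmod_power2) (simp add: power2_eq_square algebra_simps)
      finally have dN: "(N has_real_derivative m) (at x)"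
        by (simp add: has_real_derivative_iff_has_vector_derivative)
      have "N x = (norm (fst (\<Phi> x)))\<^sup>2 + (norm (snd (\<Phi> x)))\<^sup>2"
        by (simp add: N norm_prod_def)
      then have "\<bar>(norm (fst (\<Phi> x)))\<^sup>2 - (norm (snd (\<Phi> x)))\<^sup>2\<bar> \<le> N x" by (simp add: abs_le_iff)
      then have "\<bar>m\<bar> \<le> c * N x"
        unfolding m_def c_def abs_mult by (simp add: mult_left_mono)
      then have nn: "s * m + c * N x \<ge> 0" using s by (auto simp: abs_le_iff)
      have "((\<lambda>x. s * N x * exp (s * c * x)) has_real_derivative (s * m + c * N x) * exp (s * c * x)) (at x)"
      proof -
        have "((\<lambda>x. s * N x * exp (s * c * x)) has_real_derivative
            s * m * exp (s * c * x) + exp (s * c * x) * (s * c) * (s * N x)) (at x)"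
          by (rule DERIV_mult[OF DERIV_cmult[OF dN] DERIV_fun_exp[OF DERIV_cmult_Id]])
        moreover have "s * s = 1" using s by auto
        then have "s * m * exp (s * c * x) + exp (s * c * x) * (s * c) * (s * N x) = (s * m + c * N x) * exp (s * c * x)"
          by algebra
        ultimately show ?thesis by simp
      qed
      with nn show "\<exists>d\<ge>0. ((\<lambda>x. s * N x * exp (s * c * x)) has_vector_derivative d) (at x)"
        by (intro exI[of _ "(s * m + c * N x) * exp (s * c * x)"])
          (simp add: has_real_derivative_iff_has_vector_derivative)
    qed
  qed
  have N0: "N x0 = 0" by (simp add: N x0)
  have "N x \<le> 0"
  proof (cases "x \<le> x0")
    case True
    from mono[OF this, of 1] N0 show ?thesis by (simp add: mult_le_0_iff)
  next
    case False
    then have "x0 \<le> x" by simp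
    from mono[OF this, of "-1"] N0 show ?thesis by (simp add: mult_le_0_iff)
  qed
  then show ?thesis by (simp add: N)
qed

lemma not_AE_lebesgue_False: "\<not> (AE x in (lebesgue :: real measure). False)"
  using AE_iff_null_sets[of UNIV "lebesgue :: real measure"] by (auto simp: null_sets_def)

text \<open>A solution that is nonzero at one point vanishes nowhere, hence is not 0 almost
  everywhere.\<close>

lemma point_spectrum_if_hom_sol:
  assumes "hom_sol q z \<Phi>" "L2 \<Phi>" "\<Phi> x0 \<noteq> 0"
  shows "z \<in> point_spectrum_D q"
proof -
  have "Dsol q z \<Phi> (\<lambda>_. 0)" using assms by (simp add: hom_sol_def Dsol_def)
  moreover have "\<Phi> x \<noteq> 0" for x using hom_sol_zero assms(1,3) by blast
  then have "\<not> (AE x in lebesgue. \<Phi> x = 0)" using not_AE_lebesgue_False by simp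
  ultimately show ?thesis unfolding point_spectrum_D_iff by blast
qed

lemma wr_const:
  assumes "hom_sol q z \<Phi>" "hom_sol q z \<Psi>"
  shows "wr (\<Phi> x) (\<Psi> x) = wr (\<Phi> y) (\<Psi> y)"
proof (rule AC_loc_const[of "\<lambda>x. wr (\<Phi> x) (\<Psi> x)"])
  show "AC_loc (\<lambda>x. wr (\<Phi> x) (\<Psi> x))" using assms by (intro AC_loc_wr) (simp_all add: hom_sol_def)
  have "AE x in lebesgue. sys q z \<Phi> (\<lambda>_. 0) x" "AE x in lebesgue. sys q z \<Psi> (\<lambda>_. 0) x"
    using assms by (simp_all add: hom_sol_def)
  then show "AE x in lebesgue. ((\<lambda>x. wr (\<Phi> x) (\<Psi> x)) has_vector_derivative 0) (at x)"
  proof eventually_elim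
    case (elim x)
    from wr_deriv[OF this] show ?case by (simp add: wr_def)
  qed
qed

lemma hom_sol_mix:
  assumes \<psi>: "hom_sol q z1 \<psi>" "\<And>x. \<psi> x \<noteq> 0" and cd: "c * (z - cnj z1) = d * (z - z1)"
    and F: "hom_sol q z F"
  shows "hom_sol (\<lambda>x. q x + pert z1 (\<psi> x)) z (\<lambda>x. mix c d (\<psi> x) (F x))"
proof -
  have "AE x in lebesgue. sys q z1 \<psi> (\<lambda>_. 0) x" "AE x in lebesgue. sys q z F (\<lambda>_. 0) x"
    using \<psi> F by (simp_all add: hom_sol_def)
  then have "AE x in lebesgue. sys (\<lambda>x. q x + pert z1 (\<psi> x)) z (\<lambda>x. mix c d (\<psi> x) (F x)) (\<lambda>_. 0) x"
  proof eventually_elim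
    case (elim x)
    from sys_mix[OF elim(1) \<psi>(2) cd elim(2)] show ?case by simp
  qed
  then show ?thesis using \<psi> F by (simp add: hom_sol_def AC_loc_mix)
qed

lemma Dsol_mix:
  assumes \<psi>: "hom_sol q z1 \<psi>" "\<And>x. \<psi> x \<noteq> 0" and cd: "c * (z - cnj z1) = d * (z - z1)"
    and F: "Dsol q z F h"
  shows "Dsol (\<lambda>x. q x + pert z1 (\<psi> x)) z (\<lambda>x. mix c d (\<psi> x) (F x)) (\<lambda>x. mix c d (\<psi> x) (h x))"
proof -
  have "AE x in lebesgue. sys q z1 \<psi> (\<lambda>_. 0) x" "AE x in lebesgue. sys q z F h x"
    using \<psi> F by (simp_all add: hom_sol_def Dsol_def)
  then have "AE x in lebesgue. sys (\<lambda>x. q x + pert z1 (\<psi> x)) z (\<lambda>x. mix c d (\<psi> x) (F x)) (\<lambda>x. mix c d (\<psi> x) (h x)) x"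
    by eventually_elim (rule sys_mix[OF _ \<psi>(2) cd])
  then show ?thesis using \<psi> F by (simp add: hom_sol_def Dsol_def AC_loc_mix L2_mix)
qed

text \<open>The transformation based on \<open>dual\<close> leads back to \<open>q\<close>:
  \<open>pert_dual\<close> cancels the perturbation, and \<open>mix_dual\<close> exchanges
  \<open>c\<close> and \<open>d\<close>, which explains their order in \<open>cd\<close>.\<close>

lemma Dsol_unmix:
  assumes \<psi>: "\<And>x. \<psi> x \<noteq> 0" "hom_sol (\<lambda>x. q x + pert z1 (\<psi> x)) z1 (\<lambda>x. dual (\<psi> x))"
    and cd: "d * (z - cnj z1) = c * (z - z1)"
    and F: "Dsol (\<lambda>x. q x + pert z1 (\<psi> x)) z F h"
  shows "Dsol q z (\<lambda>x. mix c d (\<psi> x) (F x)) (\<lambda>x. mix c d (\<psi> x) (h x))"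
  using Dsol_mix[OF \<psi>(2) _ cd F] \<psi>(1) by (simp add: pert_dual mix_dual)

lemma bounded_map_mix:
  assumes "AC_loc \<psi>"
  shows "bounded_map (norm d + norm (c - d)) (\<lambda>F x. mix c d (\<psi> x) (F x))"
  using L2_mix[OF assms] by (simp add: bounded_map_def mix_diff)

text \<open>The similarity is \<open>z - G\<close>; its eigenvalues \<open>z - z1\<close> and
  \<open>z - cnj z1\<close> are nonzero here, and their reciprocals give the inverse.\<close>

lemma conjugate_at_mix:
  assumes \<psi>: "hom_sol q z1 \<psi>" "\<And>x. \<psi> x \<noteq> 0" "hom_sol (\<lambda>x. q x + pert z1 (\<psi> x)) z1 (\<lambda>x. dual (\<psi> x))"
    and z: "z \<noteq> z1" "z \<noteq> cnj z1"
  shows "conjugate_at q z (\<lambda>x. q x + pert z1 (\<psi> x)) z"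
  unfolding conjugate_at_def
proof (intro exI conjI allI impI)
  let ?c = "z - z1" and ?d = "z - cnj z1"
  have AC: "AC_loc \<psi>" using \<psi> by (simp add: hom_sol_def)
  show "bounded_map (norm ?d + norm (?c - ?d)) (\<lambda>F x. mix ?c ?d (\<psi> x) (F x))"
    "bounded_map (norm (1/?d) + norm (1/?c - 1/?d)) (\<lambda>F x. mix (1/?c) (1/?d) (\<psi> x) (F x))"
    by (rule bounded_map_mix[OF AC])+
  show "(\<lambda>x. mix ?c ?d (\<psi> x) (mix (1/?c) (1/?d) (\<psi> x) (F x))) = F"
    "(\<lambda>x. mix (1/?c) (1/?d) (\<psi> x) (mix ?c ?d (\<psi> x) (F x))) = F" for F
    using z by (simp_all add: mix_mix[OF \<psi>(2)])
  show "Dsol (\<lambda>x. q x + pert z1 (\<psi> x)) z (\<lambda>x. mix ?c ?d (\<psi> x) (F x)) (\<lambda>x. mix ?c ?d (\<psi> x) (h x))"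
    if "Dsol q z F h" for F h
    by (rule Dsol_mix[OF \<psi>(1,2) _ that]) simp
  show "Dsol q z (\<lambda>x. mix (1/?c) (1/?d) (\<psi> x) (F x)) (\<lambda>x. mix (1/?c) (1/?d) (\<psi> x) (h x))"
    if "Dsol (\<lambda>x. q x + pert z1 (\<psi> x)) z F h" for F h
    by (rule Dsol_unmix[OF \<psi>(2,3) _ that]) (use z in simp)
qed

section \<open>The conjugation symmetry between \<open>z\<close> and \<open>cnj z\<close>\<close>

lemma L2_conjK:
  assumes "L2 F"
  shows "L2 (\<lambda>x. conjK (F x))" and "L2norm (\<lambda>x. conjK (F x)) = L2norm F"
proof -
  have "continuous_on UNIV conjK" unfolding conjK_def by (intro continuous_intros)
  from measurable_compose[OF _ borel_measurable_continuous_onI[OF this]]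
  have "(\<lambda>x. conjK (F x)) \<in> borel_measurable lebesgue"
    using assms unfolding L2_def by blast
  then show "L2 (\<lambda>x. conjK (F x))" using assms by (simp add: L2_def)
  show "L2norm (\<lambda>x. conjK (F x)) = L2norm F" by (simp add: L2norm_def)
qed

lemma Dsol_conjK:
  assumes "Dsol q z F h"
  shows "Dsol q (cnj z) (\<lambda>x. conjK (F x)) (\<lambda>x. conjK (h x))"
proof -
  have "AE x in lebesgue. sys q (cnj z) (\<lambda>x. conjK (F x)) (\<lambda>x. conjK (h x)) x"
    using assms unfolding Dsol_def by (auto elim!: eventually_mono intro: sys_conjK)
  moreover have "AC_loc (\<lambda>x. conjK (F x))"
    unfolding conjK_def by (intro AC_loc_intros L2_Dsol(3)[OF assms])
  ultimately show ?thesis using assms by (simp add: Dsol_def L2_conjK)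
qed

lemma conjK_conjK [simp]: "conjK (conjK a) = - a"
  by (simp add: conjK_def prod_eq_iff)

lemma conjK_diff: "conjK (a - b) = conjK a - conjK b"
  and conjK_minus: "conjK (- a) = - conjK a"
  by (simp_all add: conjK_def prod_eq_iff)

text \<open>\<open>conjK\<close> squares to -1, so its inverse is its negative.\<close>

lemma conjugate_at_cnj: "conjugate_at q z q (cnj z)"
  unfolding conjugate_at_def
proof (intro exI conjI allI impI)
  show "bounded_map 1 (\<lambda>F x. conjK (F x))"
    by (simp add: bounded_map_def L2_conjK conjK_diff)
  show "bounded_map 1 (\<lambda>F x. - conjK (F x))"
    using L2_csmul(1)[OF L2_conjK(1), of _ "-1"]
    by (simp add: bounded_map_def L2_conjK conjK_diff csmul_minus_1)
  show "Dsol q (cnj z) (\<lambda>x. conjK (F x)) (\<lambda>x. conjK (h x))" if "Dsol q z F h" for F h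
    by (rule Dsol_conjK[OF that])
  show "Dsol q z (\<lambda>x. - conjK (F x)) (\<lambda>x. - conjK (h x))" if "Dsol q (cnj z) F h" for F h
    using Dsol_csmul[OF Dsol_conjK[OF that], of "-1"] by (simp add: csmul_minus_1)
qed (simp_all add: conjK_minus)

lemma point_spectrum_subset: "point_spectrum_D q \<subseteq> spectrum_D q"
  unfolding spectrum_D_def by (auto simp: resolvent_set_iff point_spectrum_D_iff)

text \<open>The resolvent bound forces the sequence itself to tend to 0.\<close>

lemma approx_compact_resolvent:
  assumes "z \<in> resolvent_set q"
  shows "approx_compact q z"
  unfolding approx_compact_def
proof (intro allI impI)
  fix F h assume D: "\<forall>n::nat. Dsol q z (F n) (h n)" and lim: "(\<lambda>n. L2norm (h n)) \<longlonglongrightarrow> 0"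
  obtain C where C: "\<And>F h. Dsol q z F h \<Longrightarrow> L2norm F \<le> C * L2norm h"
    using assms by (auto simp: resolvent_set_iff)
  have "(\<lambda>n. L2norm (F n)) \<longlonglongrightarrow> 0"
    by (rule tendsto_sandwich[OF _ _ tendsto_const tendsto_mult_right_zero[OF lim, of C]])
      (use C D in \<open>auto intro!: always_eventually\<close>)
  then show "\<exists>r g. strict_mono r \<and> L2 g \<and> (\<lambda>n. L2norm (\<lambda>x. F (r n) x - g x)) \<longlonglongrightarrow> 0"
    by (intro exI[of _ id] exI[of _ "\<lambda>_. 0"]) (simp add: strict_mono_id)
qed

lemma L2_halves:
  assumes "AC_loc \<Phi>" "L2_on {..0} F" "L2_on {0..} G"
    and "\<And>x. x \<le> 0 \<Longrightarrow> norm (\<Phi> x) \<le> C * norm (F x)" "\<And>x. x \<ge> 0 \<Longrightarrow> norm (\<Phi> x) \<le> C * norm (G x)"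
  shows "L2 \<Phi>"
proof -
  have m: "\<Phi> \<in> borel_measurable lebesgue" by (rule AC_loc_measurable[OF assms(1)])
  let ?b = "\<lambda>x. C\<^sup>2 * (indicator {..0} x * (norm (F x))\<^sup>2 + indicator {0..} x * (norm (G x))\<^sup>2)"
  have "integrable lebesgue ?b"
    using assms(2,3) unfolding L2_on_def set_integrable_def by simp
  then have "integrable lebesgue (\<lambda>x. (norm (\<Phi> x))\<^sup>2)"
  proof (rule Bochner_Integration.integrable_bound)
    show "(\<lambda>x. (norm (\<Phi> x))\<^sup>2) \<in> borel_measurable lebesgue" using m by measurable
    have "(norm (\<Phi> x))\<^sup>2 \<le> ?b x" for x :: real
    proof (cases "x \<le> 0")
      case True
      have "(norm (\<Phi> x))\<^sup>2 \<le> (C * norm (F x))\<^sup>2" by (intro power_mono assms(4) True norm_ge_zero)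
      also have "\<dots> \<le> ?b x" using True by (simp add: power_mult_distrib distrib_left)
      finally show ?thesis .
    next
      case False
      then have "(norm (\<Phi> x))\<^sup>2 \<le> (C * norm (G x))\<^sup>2" by (intro power_mono assms(5) norm_ge_zero) simp
      also have "\<dots> = ?b x" using False by (simp add: power_mult_distrib)
      finally show ?thesis .
    qed
    then show "AE x in lebesgue. norm ((norm (\<Phi> x))\<^sup>2) \<le> norm (?b x)"
      by (intro always_eventually allI) (simp add: order_trans[OF _ abs_ge_self])
  qed
  then show ?thesis using m by (simp add: L2_def)
qed

section \<open>The solution \<psi> and its dual\<close>

lemma wr_add: "wr a (b + c) = wr a b + wr a c" "wr (a + b) c = wr a c + wr b c"
  and wr_self: "wr a a = 0" and wr_swap: "wr a b = - wr b a"
  by (simp_all add: wr_def algebra_simps)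

lemma wr_csmul: "wr a (csmul c b) = c * wr a b"
  by (simp add: wr_def algebra_simps)

lemma wr_dual: "a \<noteq> 0 \<Longrightarrow> wr a (dual a) = 1"
proof -
  assume "a \<noteq> 0"
  then have "ip a a \<noteq> 0" by simp
  moreover have "wr a (conjK a) = ip a a" by (simp add: wr_def conjK_def ip_def algebra_simps)
  ultimately show ?thesis by (simp add: dual_def wr_csmul)
qed

lemma norm_dual: "norm (dual a) = 1 / norm a"
proof (cases "a = 0")
  case False
  then show ?thesis
    unfolding dual_def norm_csmul norm_conjK ip_self by (simp add: norm_divide norm_power power2_eq_square del: of_real_mult)
qed (use dual_eq_0_iff[of a] in simp)

text \<open>Otherwise the two solutions are proportional and form an eigenfunction.\<close>

lemma wr_nonzero:
  assumes z: "z \<notin> point_spectrum_D q"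
    and m: "hom_sol q z \<Psi>m" "\<Psi>m xm \<noteq> 0" "L2_on {..0} \<Psi>m"
    and p: "hom_sol q z \<Psi>p" "\<Psi>p xp \<noteq> 0" "L2_on {0..} \<Psi>p"
  shows "wr (\<Psi>m x) (\<Psi>p x) \<noteq> 0"
proof
  assume "wr (\<Psi>m x) (\<Psi>p x) = 0"
  then have W: "wr (\<Psi>m 0) (\<Psi>p 0) = 0" using wr_const[OF m(1) p(1)] by metis
  have m0: "\<Psi>m 0 \<noteq> 0" and p0: "\<Psi>p 0 \<noteq> 0" using hom_sol_zero m(1,2) p(1,2) by blast+
  define s where "s = ip (\<Psi>m 0) (\<Psi>p 0) / ip (\<Psi>m 0) (\<Psi>m 0)"
  have s: "\<Psi>p 0 = csmul s (\<Psi>m 0)"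
    using conjK_expand[OF m0, of "\<Psi>p 0"] W by (simp add: s_def prod_eq_iff)
  define \<Phi> where "\<Phi> x = csmul s (\<Psi>m x) - \<Psi>p x" for x
  have "hom_sol q z \<Phi>"
  proof -
    have AE: "AE x in lebesgue. sys q z \<Psi>m (\<lambda>_. 0) x" "AE x in lebesgue. sys q z \<Psi>p (\<lambda>_. 0) x"
      and AC: "AC_loc \<Psi>m" "AC_loc \<Psi>p"
      using m p by (simp_all add: hom_sol_def)
    have "AE x in lebesgue. sys q z \<Phi> (\<lambda>_. 0) x"
      using AE
    proof eventually_elim
      case (elim x)
      from sys_add[OF sys_csmul[OF elim(1), of s] sys_csmul[OF elim(2), of "-1"]]
      show ?case unfolding \<Phi>_def[abs_def] by (simp add: csmul_minus_1)
    qed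
    moreover have "AC_loc \<Phi>"
      unfolding \<Phi>_def[abs_def] csmul_def by (intro AC_loc_intros AC)
    ultimately show ?thesis by (simp add: hom_sol_def)
  qed
  moreover have "\<Phi> 0 = 0" by (simp add: \<Phi>_def s)
  ultimately have "\<Phi> x = 0" for x by (rule hom_sol_zero)
  then have ps: "\<Psi>p x = csmul s (\<Psi>m x)" for x by (simp add: \<Phi>_def)
  have "s \<noteq> 0" using s p0 by (auto simp: csmul_def zero_prod_def)
  have "L2 \<Psi>p"
  proof (rule L2_halves[OF _ m(3) p(3)])
    show "AC_loc \<Psi>p" using p by (simp add: hom_sol_def)
    \<comment> \<open>A common constant for both half lines: the left one requires
      \<open>norm s\<close>, the right one 1.\<close>
    show "norm (\<Psi>p x) \<le> max 1 (norm s) * norm (\<Psi>m x)" for x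
      by (simp add: ps norm_csmul mult_right_mono)
    show "norm (\<Psi>p x) \<le> max 1 (norm s) * norm (\<Psi>p x)" for x
      using mult_right_mono[of 1 "max 1 (norm s)" "norm (\<Psi>p x)"] by simp
  qed
  with p have "z \<in> point_spectrum_D q" by (intro point_spectrum_if_hom_sol)
  with z show False ..
qed

text \<open>The Wronskians of \<psi> with \<open>\<Psi>p\<close> and \<open>\<Psi>m\<close> are
  \<open>w\<close> and \<open>- w\<close>. Hence \<psi> has no zero, and the component of either
  solution orthogonal to \<psi> is a multiple of the dual. So the dual is dominated by
  \<open>\<Psi>m\<close> on the left and by \<open>\<Psi>p\<close> on the right.\<close>

lemma hom_sol_dual:
  assumes m: "hom_sol q z \<Psi>m" "L2_on {..0} \<Psi>m" and p: "hom_sol q z \<Psi>p" "L2_on {0..} \<Psi>p"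
    and W: "\<And>x. wr (\<Psi>m x) (\<Psi>p x) \<noteq> 0"
    and \<psi>: "\<psi> = (\<lambda>x. \<Psi>m x + \<Psi>p x)"
  shows "\<psi> x \<noteq> 0" and "hom_sol q z \<psi>"
    and "hom_sol (\<lambda>x. q x + pert z (\<psi> x)) z (\<lambda>x. dual (\<psi> x))" and "L2 (\<lambda>x. dual (\<psi> x))"
proof -
  define w where "w = wr (\<Psi>m 0) (\<Psi>p 0)"
  have w0: "w \<noteq> 0" using W by (simp add: w_def)
  have wc: "wr (\<Psi>m x) (\<Psi>p x) = w" for x unfolding w_def by (rule wr_const[OF m(1) p(1)])
  have wp: "wr (\<psi> x) (\<Psi>p x) = w" for x by (simp add: \<psi> wr_add wr_self wc)
  have wm: "wr (\<psi> x) (\<Psi>m x) = - w" for x using wr_swap[of "\<Psi>p x" "\<Psi>m x"] by (simp add: \<psi> wr_add wr_self wc)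
  show nz: "\<psi> x \<noteq> 0" for x using wp[of x] w0 by (auto simp: wr_def)
  have AE: "AE x in lebesgue. sys q z \<Psi>m (\<lambda>_. 0) x" "AE x in lebesgue. sys q z \<Psi>p (\<lambda>_. 0) x"
    and AC: "AC_loc \<Psi>m" "AC_loc \<Psi>p"
    using m p by (simp_all add: hom_sol_def)
  have "AE x in lebesgue. sys q z \<psi> (\<lambda>_. 0) x"
    using AE
  proof eventually_elim
    case (elim x)
    from sys_add[OF elim] show ?case by (simp add: \<psi>)
  qed
  then show h: "hom_sol q z \<psi>" using AC by (simp add: hom_sol_def \<psi> AC_loc_add)
  have mp: "mix 0 1 (\<psi> x) (\<Psi>p x) = csmul w (dual (\<psi> x))" for x by (simp add: mix_0_1[OF nz] wp)
  have mm: "mix 0 1 (\<psi> x) (\<Psi>m x) = csmul (- w) (dual (\<psi> x))" for x by (simp add: mix_0_1[OF nz] wm)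
  \<comment> \<open>The degenerate case of the transformation at its own parameter: with
    \<open>c = 0\<close> both sides of the coefficient condition are 0.\<close>
  have H: "hom_sol (\<lambda>x. q x + pert z (\<psi> x)) z (\<lambda>x. mix 0 1 (\<psi> x) (\<Psi>p x))"
    by (rule hom_sol_mix[OF h nz _ p(1)]) simp
  have d: "dual (\<psi> x) = csmul (1 / w) (mix 0 1 (\<psi> x) (\<Psi>p x))" for x
    using w0 by (simp add: mp prod_eq_iff)
  show D: "hom_sol (\<lambda>x. q x + pert z (\<psi> x)) z (\<lambda>x. dual (\<psi> x))"
  proof -
    have "AC_loc (\<lambda>x. mix 0 1 (\<psi> x) (\<Psi>p x))" 
      and ae: "AE x in lebesgue. sys (\<lambda>x. q x + pert z (\<psi> x)) z (\<lambda>x. mix 0 1 (\<psi> x) (\<Psi>p x)) (\<lambda>_. 0) x"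
      using H by (simp_all add: hom_sol_def)
    then have "AC_loc (\<lambda>x. csmul (1 / w) (mix 0 1 (\<psi> x) (\<Psi>p x)))"
      unfolding csmul_def by (intro AC_loc_Pair AC_loc_cmult AC_loc_fst AC_loc_snd)
    moreover have "AE x in lebesgue. sys (\<lambda>x. q x + pert z (\<psi> x)) z (\<lambda>x. csmul (1 / w) (mix 0 1 (\<psi> x) (\<Psi>p x))) (\<lambda>_. 0) x"
      using ae
    proof eventually_elim
      case (elim x)
      from sys_csmul[OF this, of "1 / w"] show ?case by simp
    qed
    ultimately show ?thesis unfolding d by (simp add: hom_sol_def)
  qed
  show "L2 (\<lambda>x. dual (\<psi> x))"
  proof (rule L2_halves[OF _ m(2) p(2)])
    show "AC_loc (\<lambda>x. dual (\<psi> x))" using D by (simp add: hom_sol_def)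
    have *: "norm (dual (\<psi> x)) \<le> (2 / norm w) * norm b"
      if "norm (mix 0 1 (\<psi> x) b) = norm w * norm (dual (\<psi> x))" for x b
      using norm_mix_le[of 0 1 "\<psi> x" b] w0 unfolding that by (simp add: field_simps)
    show "norm (dual (\<psi> x)) \<le> (2 / norm w) * norm (\<Psi>m x)" for x
      by (rule *) (simp add: mm norm_csmul)
    show "norm (dual (\<psi> x)) \<le> (2 / norm w) * norm (\<Psi>p x)" for x
      by (rule *) (simp add: mp norm_csmul)
  qed
qed

section \<open>The transformed operator at \<open>z1\<close>\<close>

lemma AC_loc_pert:
  assumes "AC_loc \<psi>" "\<And>x. \<psi> x \<noteq> 0"
  shows "AC_loc (\<lambda>x. pert z (\<psi> x))"
  unfolding pert_def divide_inverse using assms(2)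
  by (intro AC_loc_mult AC_loc_inverse AC_loc_ip AC_loc_cmult AC_loc_cnj AC_loc_fst AC_loc_snd assms(1)) simp_all

text \<open>The change of potential enters the Wronskian equation only through the component of
  \<open>b\<close> along \<open>a\<close>. This is the off-diagonal entry of the triangular
  form.\<close>

lemma wr_pert:
  "wr a (pert z a * snd b, - cnj (pert z a) * fst b) = 4 * complex_of_real (Im z) * fst a * snd a * (ip a b / ip a a)"
proof -
  have "cnj (ip a a) = ip a a" by (simp add: ip_self)
  then have c: "cnj (pert z a) = 4 * complex_of_real (Im z) * cnj (fst a) * snd a / ip a a"
    by (simp add: pert_def)
  have "wr a (pert z a * snd b, - cnj (pert z a) * fst b) = snd a * (pert z a * snd b) + fst a * (cnj (pert z a) * fst b)"
    by (simp add: wr_def)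
  also have "\<dots> = 4 * complex_of_real (Im z) * fst a * snd a * ((cnj (fst a) * fst b + cnj (snd a) * snd b) / ip a a)"
    unfolding c unfolding pert_def by (simp add: add_divide_distrib algebra_simps)
  finally show ?thesis by (simp only: ip_def[of a b])
qed

text \<open>At z1 itself the transformed operator is triangular with respect to the splitting into the
  span of the solution and its orthogonal complement. On the span it agrees with D(q), which is bounded
  below at z1, and on the complement it is inverted, up to the one-dimensional kernel, by the
  resolvent of D(q).\<close>

lemma Dsol_pert_modulo_dual:
  assumes z: "z \<in> resolvent_set q"
    and \<psi>: "hom_sol q z \<psi>" "\<And>x. \<psi> x \<noteq> 0" "hom_sol (\<lambda>x. q x + pert z (\<psi> x)) z (\<lambda>x. dual (\<psi> x))"
  shows "\<exists>M. \<forall>F h. Dsol (\<lambda>x. q x + pert z (\<psi> x)) z F h \<longrightarrow>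
    (\<exists>\<kappa>. L2norm (\<lambda>x. F x - csmul \<kappa> (dual (\<psi> x))) \<le> M * L2norm h)"
proof -
  obtain C where C: "\<And>F h. Dsol q z F h \<Longrightarrow> L2norm F \<le> C * L2norm h"
    using z by (auto simp: resolvent_set_iff)
  have AC: "AC_loc \<psi>" and \<psi>sys: "AE x in lebesgue. sys q z \<psi> (\<lambda>_. 0) x"
    using \<psi>(1) by (simp_all add: hom_sol_def)
  \<comment> \<open>Collects the constants for \<open>g\<close>: an outer 2 from
    \<open>L2_add\<close>, an inner 2 from projecting \<open>h\<close>, and the rest from
    \<open>g2\<close> by way of \<open>P\<close>.\<close>
  define b where "b = 2 * (2 + 2 * \<bar>Im z\<bar> * \<bar>C\<bar>)"
  show ?thesis
  proof (intro exI[of _ "2 * (\<bar>C\<bar> + 2 * \<bar>C\<bar> * b)"] allI impI)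
    fix F h assume F: "Dsol (\<lambda>x. q x + pert z (\<psi> x)) z F h"
    define P where "P x = mix 1 0 (\<psi> x) (F x)" for x
    \<comment> \<open>The inverse transformation in its degenerate form: at \<open>z1\<close> it
      retains only the component along \<psi>.\<close>
    have "Dsol q z P (\<lambda>x. mix 1 0 (\<psi> x) (h x))"
      unfolding P_def by (rule Dsol_unmix[OF \<psi>(2,3) _ F]) simp
    from C[OF this] have "L2norm P \<le> \<bar>C\<bar> * L2norm (\<lambda>x. mix 1 0 (\<psi> x) (h x))"
      by (meson L2norm_nonneg abs_ge_self mult_right_mono order_trans)
    also have "\<dots> \<le> \<bar>C\<bar> * L2norm h"
      using L2_mix(2)[OF AC L2_Dsol(2)[OF F], of 1 0] by (simp add: mult_left_mono)
    finally have P: "L2norm P \<le> \<bar>C\<bar> * L2norm h" .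
    have LP: "L2 P" unfolding P_def by (rule L2_mix[OF AC L2_Dsol(1)[OF F]])
    \<comment> \<open>The change of potential, treated as a source term, so that \<open>F\<close>
      solves the system for \<open>q\<close> with source \<open>h + k\<close>.\<close>
    define k where "k x = (pert z (\<psi> x) * snd (F x), - cnj (pert z (\<psi> x)) * fst (F x))" for x
    define g1 g2 where "g1 x = mix 0 1 (\<psi> x) (h x)" and "g2 x = mix 0 1 (\<psi> x) (k x)" for x
    have g1: "L2 g1" "L2norm g1 \<le> 2 * L2norm h"
      using L2_mix[OF AC L2_Dsol(2)[OF F], of 0 1] by (simp_all add: g1_def[abs_def])
    \<comment> \<open>The growth of the Wronskian with \<psi> is compensated by the norm of the
      dual, and 2 |u| |v| \<le> |u|^2 + |v|^2 for the components of \<psi> gives the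
      constant.\<close>
    have g2_le: "norm (g2 x) \<le> 2 * \<bar>Im z\<bar> * norm (P x)" for x
    proof -
      let ?a = "\<psi> x"
      have na: "norm ?a > 0" using \<psi>(2) by simp
      have uv: "2 * (norm (fst ?a) * norm (snd ?a)) \<le> (norm ?a)\<^sup>2"
        using zero_le_power2[of "norm (fst ?a) - norm (snd ?a)"] by (simp add: norm_prod_def power2_eq_square algebra_simps)
      have "norm (g2 x) = 4 * \<bar>Im z\<bar> * (norm (fst ?a) * norm (snd ?a)) * (norm (ip ?a (F x)) / (norm ?a)\<^sup>2) / norm ?a"
        unfolding g2_def k_def mix_0_1[OF \<psi>(2)] norm_csmul norm_dual wr_pert
        by (simp add: norm_mult norm_divide ip_self norm_power)
      also have "\<dots> = 2 * \<bar>Im z\<bar> * (norm (ip ?a (F x)) / norm ?a) * (2 * (norm (fst ?a) * norm (snd ?a)) / (norm ?a)\<^sup>2)"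
        by (simp add: mult_ac)
      also have "\<dots> \<le> 2 * \<bar>Im z\<bar> * (norm (ip ?a (F x)) / norm ?a) * 1"
        using uv na by (intro mult_left_mono) simp_all
      also have "norm (ip ?a (F x)) / norm ?a = norm (P x)"
        using na by (simp add: P_def mix_1_0 norm_csmul norm_divide ip_self norm_power power2_eq_square del: of_real_mult)
      finally show ?thesis by simp
    qed
    have g2m: "g2 \<in> borel_measurable lebesgue"
    proof -
      have p: "AC_loc (\<lambda>x. pert z (\<psi> x))" by (rule AC_loc_pert[OF AC \<psi>(2)])
      have "AC_loc k" unfolding k_def[abs_def]
        by (intro AC_loc_Pair AC_loc_mult AC_loc_minus AC_loc_cnj AC_loc_fst AC_loc_snd p L2_Dsol(3)[OF F])
      then show ?thesis unfolding g2_def[abs_def]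
        by (intro borel_measurable_mix AC_loc_measurable AC)
    qed
    have g2: "L2 g2" "L2norm g2 \<le> 2 * \<bar>Im z\<bar> * L2norm P"
      by (rule L2_dominated[OF g2m LP AE_I2[OF g2_le]]; simp)+
    define g where "g x = g1 x + g2 x" for x
    have g: "L2 g" "L2norm g \<le> b * L2norm h"
    proof -
      show "L2 g" unfolding g_def by (rule L2_add[OF g1(1) g2(1)])
      have "L2norm g \<le> 2 * (L2norm g1 + L2norm g2)" unfolding g_def by (rule L2_add[OF g1(1) g2(1)])
      also have "\<dots> \<le> 2 * (2 * L2norm h + 2 * \<bar>Im z\<bar> * (\<bar>C\<bar> * L2norm h))"
        using g1(2) order_trans[OF g2(2) mult_left_mono[OF P, of "2 * \<bar>Im z\<bar>"]] by simp
      finally show "L2norm g \<le> b * L2norm h" by (simp add: b_def algebra_simps)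
    qed
    obtain f where f: "Dsol q z f g" using z g(1) by (auto simp: resolvent_set_iff)
    have fn: "L2norm f \<le> \<bar>C\<bar> * (b * L2norm h)"
      by (rule order_trans[OF C[OF f]], rule order_trans[OF mult_right_mono[OF abs_ge_self] mult_left_mono[OF g(2)]]) simp_all
    \<comment> \<open>Both Wronskians have the same derivative, so their difference is constant; it
      is the coefficient of the eigenfunction to be subtracted.\<close>
    define w where "w x = wr (\<psi> x) (F x) - wr (\<psi> x) (f x)" for x
    have wc: "w x = w 0" for x
    proof (rule AC_loc_const)
      show "AC_loc w" unfolding w_def[abs_def]
        by (intro AC_loc_diff AC_loc_wr AC L2_Dsol(3)[OF F] L2_Dsol(3)[OF f])
      have "AE x in lebesgue. sys q z F (\<lambda>t. h t + k t) x" "AE x in lebesgue. sys q z f g x"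
        using F f unfolding Dsol_def sys_shift k_def by simp_all
      with \<psi>sys show "AE x in lebesgue. (w has_vector_derivative 0) (at x)"
      proof eventually_elim
        case (elim x)
        \<comment> \<open>Projecting onto the complement of \<psi> leaves the Wronskian with \<psi>
          unchanged.\<close>
        have "wr (\<psi> x) (g x) = wr (\<psi> x) (h x + k x)"
          by (simp add: g_def g1_def g2_def mix_0_1[OF \<psi>(2)] wr_add wr_csmul wr_dual[OF \<psi>(2)])
        with has_vector_derivative_diff[OF wr_deriv[OF elim(1,2)] wr_deriv[OF elim(1,3)]]
        show ?case by (simp add: w_def[abs_def])
      qed
    qed
    have split: "F x - csmul (w 0) (dual (\<psi> x)) = P x + mix 0 1 (\<psi> x) (f x)" for x
    proof -
      have "F x = P x + csmul (wr (\<psi> x) (F x)) (dual (\<psi> x))"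
        using mix_sum[of "\<psi> x" "F x"] by (simp add: P_def mix_0_1[OF \<psi>(2)])
      moreover have "w 0 = wr (\<psi> x) (F x) - wr (\<psi> x) (f x)" using wc[of x] by (simp add: w_def)
      ultimately show ?thesis
        by (simp add: mix_0_1[OF \<psi>(2)] prod_eq_iff) (simp add: algebra_simps)
    qed
    show "\<exists>\<kappa>. L2norm (\<lambda>x. F x - csmul \<kappa> (dual (\<psi> x))) \<le> (2 * (\<bar>C\<bar> + 2 * \<bar>C\<bar> * b)) * L2norm h"
    proof (intro exI)
      have "L2norm (\<lambda>x. F x - csmul (w 0) (dual (\<psi> x))) \<le> 2 * (L2norm P + L2norm (\<lambda>x. mix 0 1 (\<psi> x) (f x)))"
        unfolding split by (rule L2_add[OF LP L2_mix(1)[OF AC L2_Dsol(1)[OF f]]])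
      also have "\<dots> \<le> 2 * (\<bar>C\<bar> * L2norm h + 2 * (\<bar>C\<bar> * (b * L2norm h)))"
        using P L2_mix(2)[OF AC L2_Dsol(1)[OF f], of 0 1] fn by simp
      finally show "L2norm (\<lambda>x. F x - csmul (w 0) (dual (\<psi> x))) \<le> (2 * (\<bar>C\<bar> + 2 * \<bar>C\<bar> * b)) * L2norm h"
        by (simp add: algebra_simps)
    qed
  qed
qed

text \<open>The distance to the line spanned by \<open>e\<close> tends to 0, and the coefficients
  \<kappa> are bounded because the sequence is; so Bolzano-Weierstrass in the complex plane yields
  the subsequence.\<close>

lemma approx_compact_modulo:
  assumes e: "L2 e" "L2norm e > 0"
    and M: "\<And>F h. Dsol q z F h \<Longrightarrow> \<exists>\<kappa>. L2norm (\<lambda>x. F x - csmul \<kappa> (e x)) \<le> M * L2norm h"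
  shows "approx_compact q z"
  unfolding approx_compact_def
proof (intro allI impI)
  fix F h assume D: "\<forall>n::nat. Dsol q z (F n) (h n)" and "\<exists>B. \<forall>n. L2norm (F n) \<le> B"
    and lim: "(\<lambda>n. L2norm (h n)) \<longlonglongrightarrow> 0"
  then obtain B where B: "\<And>n. L2norm (F n) \<le> B" by blast
  have "\<forall>n. \<exists>\<kappa>. L2norm (\<lambda>x. F n x - csmul \<kappa> (e x)) \<le> M * L2norm (h n)"
    using M[OF D[rule_format]] by blast
  from choice[OF this] obtain \<kappa> where \<kappa>: "\<And>n. L2norm (\<lambda>x. F n x - csmul (\<kappa> n) (e x)) \<le> M * L2norm (h n)"
    by blast
  have LF: "L2 (F n)" for n using D by (blast intro: L2_Dsol)
  have lim1: "(\<lambda>n. L2norm (\<lambda>x. F n x - csmul (\<kappa> n) (e x))) \<longlonglongrightarrow> 0"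
    by (rule tendsto_sandwich[OF _ _ tendsto_const tendsto_mult_right_zero[OF lim, of M]])
      (auto intro!: always_eventually \<kappa>)
  then have "Bseq (\<lambda>n. L2norm (\<lambda>x. F n x - csmul (\<kappa> n) (e x)))"
    using convergentI convergent_imp_Bseq by blast
  then obtain A where A: "\<And>n. L2norm (\<lambda>x. F n x - csmul (\<kappa> n) (e x)) \<le> A"
    by (auto simp: Bseq_def)
  have "norm (\<kappa> n) \<le> 2 * (B + A) / L2norm e" for n
  proof -
    have "norm (\<kappa> n) * L2norm e = L2norm (\<lambda>x. csmul (\<kappa> n) (e x))" by (simp add: L2_csmul(2)[OF e(1)])
    also have "\<dots> = L2norm (\<lambda>x. F n x - (F n x - csmul (\<kappa> n) (e x)))" by simp
    also have "\<dots> \<le> 2 * (L2norm (F n) + L2norm (\<lambda>x. F n x - csmul (\<kappa> n) (e x)))"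
      by (intro L2_diff LF L2_csmul e(1))
    also have "\<dots> \<le> 2 * (B + A)" using B[of n] A[of n] by simp
    finally show ?thesis using e(2) by (simp add: field_simps)
  qed
  then have "bounded (range \<kappa>)" by (auto simp: bounded_iff)
  then obtain l r where r: "strict_mono r" and l: "(\<kappa> \<circ> r) \<longlonglongrightarrow> l"
    using bounded_imp_convergent_subsequence by blast
  have le: "L2norm (\<lambda>x. F (r n) x - csmul l (e x)) \<le>
     2 * (L2norm (\<lambda>x. F (r n) x - csmul (\<kappa> (r n)) (e x)) + norm (\<kappa> (r n) - l) * L2norm e)" for n
  proof -
    have 1: "(\<lambda>x. F (r n) x - csmul l (e x)) = (\<lambda>x. (F (r n) x - csmul (\<kappa> (r n)) (e x)) + csmul (\<kappa> (r n) - l) (e x))"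
      by (simp add: fun_eq_iff prod_eq_iff left_diff_distrib)
    show ?thesis
      unfolding 1 using L2_add(2)[OF L2_diff(1)[OF LF L2_csmul(1)[OF e(1)]] L2_csmul(1)[OF e(1)], of "r n" "\<kappa> (r n)" "\<kappa> (r n) - l"]
      unfolding L2_csmul(2)[OF e(1)] .
  qed
  have "(\<lambda>n. 2 * (L2norm (\<lambda>x. F (r n) x - csmul (\<kappa> (r n)) (e x)) + norm (\<kappa> (r n) - l) * L2norm e)) \<longlonglongrightarrow>
      2 * (0 + norm (l - l) * L2norm e)"
    using l LIMSEQ_subseq_LIMSEQ[OF lim1 r] unfolding o_def by (intro tendsto_intros)
  then have "(\<lambda>n. 2 * (L2norm (\<lambda>x. F (r n) x - csmul (\<kappa> (r n)) (e x)) + norm (\<kappa> (r n) - l) * L2norm e)) \<longlonglongrightarrow> 0"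
    by simp
  then have "(\<lambda>n. L2norm (\<lambda>x. F (r n) x - csmul l (e x))) \<longlonglongrightarrow> 0"
    by (rule tendsto_sandwich[OF _ _ tendsto_const, rotated 2])
      (intro always_eventually allI L2norm_nonneg le)+
  then show "\<exists>r g. strict_mono r \<and> L2 g \<and> (\<lambda>n. L2norm (\<lambda>x. F (r n) x - g x)) \<longlonglongrightarrow> 0"
    by (intro exI[of _ r] exI[of _ "\<lambda>x. csmul l (e x)"] conjI r L2_csmul(1)[OF e(1)])
qed

theorem theorem6p15:
  fixes q :: "real \<Rightarrow> complex" and z1 :: complex
    and \<Psi>m \<Psi>p :: "real \<Rightarrow> complex \<times> complex"
  assumes "L1loc q"
    and "z1 \<in> resolvent_set q"
    and "wave_function q z1 \<Psi>m" and "\<forall>R. L2_on {..R} \<Psi>m"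
    and "wave_function q z1 \<Psi>p" and "\<forall>R. L2_on {R..} \<Psi>p"
  defines "q1 \<equiv> (\<lambda>x. q x + 4 * complex_of_real (Im z1) * fst (\<Psi>m x + \<Psi>p x)
                  * cnj (snd (\<Psi>m x + \<Psi>p x)) / complex_of_real ((norm (\<Psi>m x + \<Psi>p x))\<^sup>2))"
  shows "spectrum_D q1 = spectrum_D q \<union> {z1, cnj z1} \<and>
         point_spectrum_D q1 = point_spectrum_D q \<union> {z1, cnj z1} \<and>
         ess_spectrum_D q1 = ess_spectrum_D q"
proof -
  define \<psi> where "\<psi> = (\<lambda>x. \<Psi>m x + \<Psi>p x)"
  have q1: "q1 = (\<lambda>x. q x + pert z1 (\<psi> x))"
    unfolding q1_def pert_def \<psi>_def ip_self ..
  obtain xm xp where m: "hom_sol q z1 \<Psi>m" "\<Psi>m xm \<noteq> 0" "L2_on {..0} \<Psi>m"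
    and p: "hom_sol q z1 \<Psi>p" "\<Psi>p xp \<noteq> 0" "L2_on {0..} \<Psi>p"
    using assms(3-6) unfolding wave_function_iff by blast
  have "z1 \<notin> point_spectrum_D q"
    using assms(2) point_spectrum_subset unfolding spectrum_D_def by blast
  note W = wr_nonzero[OF this m p]
  note \<psi> = hom_sol_dual[OF m(1,3) p(1,3) W \<psi>_def, folded q1]
  have z1p: "z1 \<in> point_spectrum_D q1"
    by (rule point_spectrum_if_hom_sol[OF \<psi>(3,4), of 0]) (simp add: \<psi>(1))
  have z1c: "cnj z1 \<in> point_spectrum_D q1"
    using z1p conjugate_at_iff(2)[OF conjugate_at_cnj[of q1 z1]] by blast
  have "L2norm (\<lambda>x. dual (\<psi> x)) > 0"
  proof -
    have "\<not> (AE x in lebesgue. dual (\<psi> x) = 0)" using not_AE_lebesgue_False by (simp add: \<psi>(1))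
    then have "L2norm (\<lambda>x. dual (\<psi> x)) \<noteq> 0" using L2norm_eq_0_iff[OF \<psi>(4)] by simp
    then show ?thesis by (simp add: less_le)
  qed
  moreover obtain M where "\<And>F h. Dsol q1 z1 F h \<Longrightarrow> \<exists>\<kappa>. L2norm (\<lambda>x. F x - csmul \<kappa> (dual (\<psi> x))) \<le> M * L2norm h"
    using Dsol_pert_modulo_dual[OF assms(2) \<psi>(2,1), folded q1, OF \<psi>(3)] by blast
  ultimately have "approx_compact q1 z1"
    by (intro approx_compact_modulo[OF \<psi>(4)])
  then have z1e: "z1 \<notin> ess_spectrum_D q1" by (simp add: ess_spectrum_D_iff)
  then have z1ce: "cnj z1 \<notin> ess_spectrum_D q1"
    using conjugate_at_iff(3)[OF conjugate_at_cnj[of q1 z1]] by blast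
  have z1q: "z1 \<notin> ess_spectrum_D q"
    using approx_compact_resolvent[OF assms(2)] by (simp add: ess_spectrum_D_iff)
  then have z1cq: "cnj z1 \<notin> ess_spectrum_D q"
    using conjugate_at_iff(3)[OF conjugate_at_cnj[of q z1]] by blast
  \<comment> \<open>Away from \<open>z1\<close> and \<open>cnj z1\<close> all three spectra transfer
    by similarity; the two exceptional points have been settled above.\<close>
  have "conjugate_at q z q1 z" if "z \<noteq> z1" "z \<noteq> cnj z1" for z
    using conjugate_at_mix[OF \<psi>(2,1) _ that] \<psi>(3) unfolding q1 by blast
  note off = conjugate_at_iff[OF this]
  have "z \<in> spectrum_D q1 \<longleftrightarrow> z \<in> spectrum_D q \<union> {z1, cnj z1}" for z
    using off(1)[of z] z1p z1c point_spectrum_subset[of q1] by blast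
  moreover have "z \<in> point_spectrum_D q1 \<longleftrightarrow> z \<in> point_spectrum_D q \<union> {z1, cnj z1}" for z
    using off(2)[of z] z1p z1c by blast
  moreover have "z \<in> ess_spectrum_D q1 \<longleftrightarrow> z \<in> ess_spectrum_D q" for z
    using off(3)[of z] z1e z1ce z1q z1cq by blast
  ultimately show ?thesis by blast
qed

end
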